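(* Let $\Bbbk$ be a field, $N\ge3$, and let $\mathrm{n}\widehat{\mathrm{TL}}_N$ be the affine nilTemperley-Lieb algebra. For $1\le k\le N-1$ let $$\mathbf t_k=(-1)^{k-1}\sum_{|I|=k}a(\hat I)\in \mathrm{n}\widehat{\mathrm{TL}}_N,$$ where the sum is over all $I=\{1\le i_1<\dots<i_k\le N\}$ of length $k$ and $a(\hat I)$ is the monomial defined in the context. Then: 1. $\mathbf t_k$ is central for all $1\le k\le N-1$, and the center of $\mathrm{n}\widehat{\mathrm{TL}}_N$ is generated (as an algebra) by $1$ and the $\mathbf t_k$, $1\le k\le N-1$. 2. For all $1\le k\le N-1$ the subalgebra generated by $\mathbf t_k$ is isomorphic to the polynomial ring $\Bbbk[q]$. Moreover $\mathbf t_k\mathbf t_\ell=0$ for all $k\ne\ell$. Hence the center of $\mathrm{n}\widehat{\mathrm{TL}}_N$ is the subalgebra $$\mathsf C_N=\Bbbk\oplus\mathbf t_1\Bbbk[\mathbf t_1]\oplus\dots\oplus\mathbf t_{N-1}\Bbbk[\mathbf t_{N-1}]\cong\frac{\Bbbk[\mathbf t_1,\dots,\mathbf t_{N-1}]}{(\mathbf t_k\mathbf t_\ell\mid k\ne\ell)},$$ where on the right the $\mathbf t_k$ denote independent commuting indeterminates.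
   Context: The affine nilTemperley-Lieb algebra $\mathrm{n}\widehat{\mathrm{TL}}_N$ ($N\ge3$) is the unital associative $\Bbbk$-algebra with generators $a_0,\dots,a_{N-1}$ and relations $a_i^2=0$, $a_ia_j=a_ja_i$ for $i-j\not\equiv\pm1 \pmod N$, and $a_ia_{i+1}a_i=a_{i+1}a_ia_{i+1}=0$ for all $i$, all indices modulo $N$ (so $a_N=a_0$). For $I=\{1\le i_1<\dots<i_k\le N\}$ with $1\le k\le N-1$, choose a gap: an index $\ell\in\{1,\dots,k\}$ with $i_\ell+1<i_{\ell+1}$, where $i_{k+1}:=i_1+N$ (such $\ell$ exists since $k<N$). Define $$a(\hat I)=(a_{i_1-1}a_{i_1-2}\cdots a_{i_k+2}a_{i_k+1})\cdot\prod_{s=1}^{k-1}(a_{i_{s+1}-1}a_{i_{s+1}-2}\cdots a_{i_s+2}a_{i_s+1})\cdot(a_{i_{\ell+1}}a_{i_{\ell+2}}\cdots a_{i_k})\cdot(a_{i_1}a_{i_2}\cdots a_{i_\ell}),$$ indices modulo $N$; the first factor has indices $i_1+N-1,i_1+N-2,\dots,i_k+1$ reduced modulo $N$, and empty products are $1$. As an element of the algebra, $a(\hat I)$ depends only on $I$. *)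

theory Defs
  imports "HOL-Algebra.Algebra" "HOL-Library.Poly_Mapping" "HOL-Computational_Algebra.Polynomial"
begin

text \<open>
  The product of \<^typ>\<open>'m::monoid_add \<Rightarrow>\<^sub>0 'k::ring_1\<close> is convolution over the
  additively written monoid \<^typ>\<open>'m\<close>. With words under concatenation as exponents it
  is the free associative algebra, with \<^typ>\<open>nat \<Rightarrow>\<^sub>0 nat\<close> it is the commutative
  polynomial algebra in countably many indeterminates.
\<close>

datatype word = Word (letters: "nat list")

instantiation word :: monoid_add
begin

definition zero_word :: word where "0 = Word []"

definition plus_word :: "word \<Rightarrow> word \<Rightarrow> word" where
  "v + w = Word (letters v @ letters w)"

instance
  by standard (simp_all add: zero_word_def plus_word_def)

end

definition ring_on :: "'a::ring_1 set \<Rightarrow> 'a ring" where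
  "ring_on S = \<lparr>carrier = S, monoid.mult = (*), one = 1, ring.zero = 0, ring.add = (+)\<rparr>"


text \<open>
  A \<^typ>\<open>'k\<close>-algebra is given by a ring \<open>R\<close> together with its structure
  map \<open>s\<close>, which sends a scalar \<open>c\<close> to \<open>c\<close> times the unit of \<open>R\<close>.
\<close>

definition alg_iso ::
  "('a, 'm) ring_scheme \<Rightarrow> ('k \<Rightarrow> 'a) \<Rightarrow> ('b, 'n) ring_scheme \<Rightarrow> ('k \<Rightarrow> 'b) \<Rightarrow> ('a \<Rightarrow> 'b) set"
  where "alg_iso R s R' s' = {h \<in> ring_iso R R'. \<forall>c. h (s c) = s' c}"

definition gen_subalgebra :: "('a, 'm) ring_scheme \<Rightarrow> ('k \<Rightarrow> 'a) \<Rightarrow> 'a set \<Rightarrow> 'a set" where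
  "gen_subalgebra R s S = generate_ring R (range s \<union> S)"

definition ring_center :: "('a, 'm) ring_scheme \<Rightarrow> 'a set" where
  "ring_center R = {z \<in> carrier R. \<forall>x\<in>carrier R. z \<otimes>\<^bsub>R\<^esub> x = x \<otimes>\<^bsub>R\<^esub> z}"

definition sum_of_subspaces :: "('a, 'm) ring_scheme \<Rightarrow> 'i set \<Rightarrow> ('i \<Rightarrow> 'a set) \<Rightarrow> 'a set" where
  "sum_of_subspaces R J V = (\<lambda>f. finsum R f J) ` Pi\<^sub>E J V"

text \<open>
  In HOL-Algebra, \<^term>\<open>subalgebra K V R\<close> only says that \<open>V\<close> is an additive
  subgroup of \<open>R\<close> closed under multiplication by \<open>K\<close>, i.e. a subspace.
\<close>

definition sum_is_direct ::
  "('a, 'm) ring_scheme \<Rightarrow> ('k \<Rightarrow> 'a) \<Rightarrow> 'i set \<Rightarrow> ('i \<Rightarrow> 'a set) \<Rightarrow> bool" where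
  "sum_is_direct R s J V \<longleftrightarrow>
     (\<forall>j\<in>J. subalgebra (range s) (V j) R) \<and> inj_on (\<lambda>f. finsum R f J) (Pi\<^sub>E J V)"


definition free_alg :: "nat \<Rightarrow> (word \<Rightarrow>\<^sub>0 'k::field) ring" where
  "free_alg N = ring_on {p. \<forall>w\<in>Poly_Mapping.keys p. set (letters w) \<subseteq> {..<N}}"

definition free_gen :: "nat \<Rightarrow> nat \<Rightarrow> (word \<Rightarrow>\<^sub>0 'k::field)" where
  "free_gen N i = Poly_Mapping.single (Word [i mod N]) 1"

definition nTL_rels :: "nat \<Rightarrow> (word \<Rightarrow>\<^sub>0 'k::field) set" where
  "nTL_rels N = (let a = free_gen N in
     {a i * a i | i. i < N}
   \<union> {a i * a j - a j * a i | i j. i < N \<and> j < N \<and>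
        (i + 1) mod N \<noteq> j \<and> (j + 1) mod N \<noteq> i}
   \<union> {a i * a (i + 1) * a i | i. i < N}
   \<union> {a (i + 1) * a i * a (i + 1) | i. i < N})"

definition nTL_ideal :: "nat \<Rightarrow> (word \<Rightarrow>\<^sub>0 'k::field) set" where
  "nTL_ideal N = Idl\<^bsub>free_alg N\<^esub> (nTL_rels N)"

definition nTL :: "nat \<Rightarrow> (word \<Rightarrow>\<^sub>0 'k::field) set ring" where
  "nTL N = free_alg N Quot nTL_ideal N"

definition nTL_scalar :: "nat \<Rightarrow> 'k::field \<Rightarrow> (word \<Rightarrow>\<^sub>0 'k) set" where
  "nTL_scalar N c = nTL_ideal N +>\<^bsub>free_alg N\<^esub> Poly_Mapping.single 0 c"

definition nTL_gen :: "nat \<Rightarrow> nat \<Rightarrow> (word \<Rightarrow>\<^sub>0 'k::field) set" where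
  "nTL_gen N i = nTL_ideal N +>\<^bsub>free_alg N\<^esub> free_gen N i"

definition nTL_monom :: "nat \<Rightarrow> nat list \<Rightarrow> (word \<Rightarrow>\<^sub>0 'k::field) set" where
  "nTL_monom N js = foldr (\<lambda>j x. nTL_gen N j \<otimes>\<^bsub>nTL N\<^esub> x) js \<one>\<^bsub>nTL N\<^esub>"


text \<open>
  \<open>idx N I s\<close> is \<open>i\<^sub>s\<close> for \<open>1 \<le> s \<le> k + 1\<close>, where
  \<open>I = {i\<^sub>1 < \<dots> < i\<^sub>k}\<close> and \<open>i\<^sub>k\<^sub>+\<^sub>1 = i\<^sub>1 + N\<close>.
\<close>

definition idx :: "nat \<Rightarrow> nat set \<Rightarrow> nat \<Rightarrow> nat" where
  "idx N I s = (if s \<le> card I then sorted_list_of_set I ! (s - 1)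
                else sorted_list_of_set I ! 0 + N)"

definition gaps :: "nat \<Rightarrow> nat set \<Rightarrow> nat set" where
  "gaps N I = {l \<in> {1..card I}. idx N I l + 1 < idx N I (l + 1)}"

text \<open>
  \<open>rev [idx N I s + 1..<idx N I (s + 1)]\<close> lists the indices
  \<open>i\<^sub>s\<^sub>+\<^sub>1 - 1, \<dots>, i\<^sub>s + 1\<close> in descending order. The reduction modulo \<open>N\<close>
  takes place in \<^const>\<open>free_gen\<close>.
\<close>

definition a_hat :: "nat \<Rightarrow> nat set \<Rightarrow> nat \<Rightarrow> (word \<Rightarrow>\<^sub>0 'k::field) set" where
  "a_hat N I l = (let k = card I; i = idx N I in
     nTL_monom N
       (rev [i k + 1..<i (k + 1)]
        @ concat (map (\<lambda>s. rev [i s + 1..<i (s + 1)]) [1..<k])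
        @ map i [l + 1..<k + 1]
        @ map i [1..<l + 1]))"

text \<open>
  The choice of a gap for each \<open>I\<close>, on which \<^const>\<open>a_hat\<close> does not really
  depend, is passed as the argument \<open>gap\<close>.
\<close>

definition t_elem :: "nat \<Rightarrow> (nat set \<Rightarrow> nat) \<Rightarrow> nat \<Rightarrow> (word \<Rightarrow>\<^sub>0 'k::field) set" where
  "t_elem N gap k =
     nTL_scalar N ((- 1) ^ (k - 1)) \<otimes>\<^bsub>nTL N\<^esub>
     (\<Oplus>\<^bsub>nTL N\<^esub> I \<in> {I. I \<subseteq> {1..N} \<and> card I = k}. a_hat N I (gap I))"

definition C_summand :: "nat \<Rightarrow> (nat set \<Rightarrow> nat) \<Rightarrow> nat \<Rightarrow> (word \<Rightarrow>\<^sub>0 'k::field) set set" where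
  "C_summand N gap j =
     (if j = 0 then range (nTL_scalar N)
      else (\<lambda>x. t_elem N gap j \<otimes>\<^bsub>nTL N\<^esub> x) `
             gen_subalgebra (nTL N) (nTL_scalar N) {t_elem N gap j})"

definition C_alg :: "nat \<Rightarrow> (nat set \<Rightarrow> nat) \<Rightarrow> (word \<Rightarrow>\<^sub>0 'k::field) set set" where
  "C_alg N gap = sum_of_subspaces (nTL N) {0..N - 1} (C_summand N gap)"


definition mpoly_ring :: "nat set \<Rightarrow> ((nat \<Rightarrow>\<^sub>0 nat) \<Rightarrow>\<^sub>0 'k::field) ring" where
  "mpoly_ring V = ring_on {p. \<forall>m\<in>Poly_Mapping.keys p. Poly_Mapping.keys m \<subseteq> V}"

definition mvar :: "nat \<Rightarrow> ((nat \<Rightarrow>\<^sub>0 nat) \<Rightarrow>\<^sub>0 'k::field)" where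
  "mvar k = Poly_Mapping.single (Poly_Mapping.single k 1) 1"

definition cross_ideal :: "nat \<Rightarrow> ((nat \<Rightarrow>\<^sub>0 nat) \<Rightarrow>\<^sub>0 'k::field) set" where
  "cross_ideal N = Idl\<^bsub>mpoly_ring {1..N - 1}\<^esub>
     {mvar k * mvar l | k l. k \<in> {1..N - 1} \<and> l \<in> {1..N - 1} \<and> k \<noteq> l}"

definition cross_ring :: "nat \<Rightarrow> ((nat \<Rightarrow>\<^sub>0 nat) \<Rightarrow>\<^sub>0 'k::field) set ring" where
  "cross_ring N = mpoly_ring {1..N - 1} Quot cross_ideal N"

definition cross_class :: "nat \<Rightarrow> ((nat \<Rightarrow>\<^sub>0 nat) \<Rightarrow>\<^sub>0 'k::field) \<Rightarrow> ((nat \<Rightarrow>\<^sub>0 nat) \<Rightarrow>\<^sub>0 'k) set" where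
  "cross_class N p = cross_ideal N +>\<^bsub>mpoly_ring {1..N - 1}\<^esub> p"

end

theory Submission
  imports Defs
begin

text \<open>
  The proof rests on a faithful representation by particles on a circle. A configuration is a subset
  of the places \<open>0, \<dots>, N - 1\<close>. The generator \<open>a\<^sub>j\<close> moves a particle from \<open>j\<close> to \<open>j + 1\<close> modulo \<open>N\<close>, with
  weight \<open>q\<close> if \<open>j = 0\<close>, and gives zero if there is no particle at \<open>j\<close> or if \<open>j + 1\<close> is occupied. An
  element of the algebra thus becomes a matrix over \<open>'k[q]\<close> indexed by configurations.

  The representation is faithful (\<open>mat_faithful\<close>) because every place is filled and emptied alternately.
  A word that kills all configurations therefore contains, up to commutations, a factor \<open>i i\<close> or
  \<open>i n i\<close> with a neighbour \<open>n\<close> of \<open>i\<close> (\<open>run_None_in_ideal\<close>), and two words with the same nonzero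
  matrix entry differ by commutations only (\<open>same_counts_eqv\<close>).

  Comparing matrix entries of \<open>a x = x a\<close> for a generator \<open>x\<close> shows that a central element \<open>a\<close> is
  diagonal (\<open>center_diagonal\<close>) and that its diagonal entry depends only on the number \<open>j\<close> of particles
  (\<open>center_constant_diagonal\<close>). These scalars \<open>chi j a\<close>, for \<open>j\<close> from \<open>1\<close> to \<open>N - 1\<close>, determine \<open>a\<close>
  (\<open>center_eqI\<close>). They have the same constant coefficient, which is the coefficient of the empty word.

  The monomial of an index set moves each particle to the place of the next one. So it acts on a single
  configuration, which it fixes with weight \<open>q\<close> (\<open>rep_a_hat\<close>), and the sum over all index sets of
  size \<open>k\<close> is \<open>q\<close> on \<open>k\<close> particles and zero elsewhere. Up to a sign, this is \<open>t k\<close>. Hence \<open>chi\<close> identifies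
  the center with the families of \<open>N - 1\<close> polynomials in \<open>q\<close> that have a common constant coefficient, and
  \<open>t k\<close> with the family that has \<open>q\<close> or \<open>- q\<close> in position \<open>k\<close> and zero elsewhere. On these
  families all assertions are visible: they also form the coordinate ring of the union of the coordinate axes,
  which is the quotient of the polynomial ring by the products of two distinct variables
  (\<open>cross_ideal_iff\<close>).
\<close>


section \<open>Linear extension from a basis of monomials\<close>

definition lin_ext :: "('m \<Rightarrow> 'k::field poly) \<Rightarrow> ('m \<Rightarrow>\<^sub>0 'k) \<Rightarrow> 'k poly" where
  "lin_ext \<phi> p = (\<Sum>m\<in>Poly_Mapping.keys p. smult (Poly_Mapping.lookup p m) (\<phi> m))"

lemma lin_ext_superset:
  assumes "finite K" "Poly_Mapping.keys p \<subseteq> K"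
  shows "lin_ext \<phi> p = (\<Sum>m\<in>K. smult (Poly_Mapping.lookup p m) (\<phi> m))"
  unfolding lin_ext_def using assms
  by (intro sum.mono_neutral_left) (auto simp: in_keys_iff)

lemma lin_ext_zero [simp]: "lin_ext \<phi> 0 = 0"
  by (simp add: lin_ext_def)

lemma lin_ext_single [simp]: "lin_ext \<phi> (Poly_Mapping.single m c) = smult c (\<phi> m)"
  by (cases "c = 0") (auto simp: lin_ext_def)

lemma lin_ext_add [simp]: "lin_ext \<phi> (p + q) = lin_ext \<phi> p + lin_ext \<phi> q"
proof -
  let ?K = "Poly_Mapping.keys p \<union> Poly_Mapping.keys q"
  have "Poly_Mapping.keys (p + q) \<subseteq> ?K" by (rule Poly_Mapping.keys_add)
  then have "lin_ext \<phi> (p + q) = (\<Sum>m\<in>?K. smult (Poly_Mapping.lookup (p + q) m) (\<phi> m))"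
    by (intro lin_ext_superset) auto
  also have "\<dots> = lin_ext \<phi> p + lin_ext \<phi> q"
    by (simp add: lin_ext_superset[where K = ?K] lookup_add smult_add_left sum.distrib)
  finally show ?thesis .
qed

lemma lin_ext_uminus [simp]: "lin_ext \<phi> (- p) = - lin_ext \<phi> p"
  using lin_ext_add[of \<phi> p "- p"] by (simp add: eq_neg_iff_add_eq_0 add.commute)

lemma lin_ext_diff [simp]: "lin_ext \<phi> (p - q) = lin_ext \<phi> p - lin_ext \<phi> q"
  using lin_ext_add[of \<phi> p "- q"] by simp

lemma lin_ext_sum: "lin_ext \<phi> (\<Sum>x\<in>F. f x) = (\<Sum>x\<in>F. lin_ext \<phi> (f x))"
  by (induction F rule: infinite_finite_induct) auto

lemma sum_of_singles:
  fixes p :: "'m \<Rightarrow>\<^sub>0 'k::comm_monoid_add"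
  shows
  "(\<Sum>m\<in>Poly_Mapping.keys p. Poly_Mapping.single m (Poly_Mapping.lookup p m)) = p"
proof (rule poly_mapping_eqI)
  fix m
  show "Poly_Mapping.lookup (\<Sum>m\<in>Poly_Mapping.keys p. Poly_Mapping.single m (Poly_Mapping.lookup p m)) m
      = Poly_Mapping.lookup p m"
    by (cases "m \<in> Poly_Mapping.keys p")
      (auto simp: lookup_sum lookup_single when_def sum.delta' in_keys_iff)
qed

lemma additive_induct [case_names single add]:
  fixes p :: "'m \<Rightarrow>\<^sub>0 'k::comm_monoid_add"
  assumes single: "\<And>m c. P (Poly_Mapping.single m c)"
    and add: "\<And>p q. P p \<Longrightarrow> P q \<Longrightarrow> P (p + q)"
  shows "P p"
proof -
  have "P (\<Sum>m\<in>F. Poly_Mapping.single m (Poly_Mapping.lookup p m))" for F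
  proof (induction F rule: infinite_finite_induct)
    case (insert x F) then show ?case by (simp add: add single)
  qed (use single[of _ 0] in auto)
  then show ?thesis using sum_of_singles[of p] by metis
qed

lemma smult_sum_right: "smult c (\<Sum>u\<in>F. f u) = (\<Sum>u\<in>F. smult c (f u))"
  by (induction F rule: infinite_finite_induct) (auto simp: smult_add_right)

text \<open>
  The expansion of \<open>\<phi> (m + n)\<close> as a finite sum of products covers both cases needed here:
  matrix coefficients of a monoid representation, where the index \<open>u\<close> runs through a basis,
  and characters of a monoid, where there is one summand.
\<close>

lemma lin_ext_mult:
  fixes \<phi> :: "'m::monoid_add \<Rightarrow> 'k::field poly"
  assumes "\<And>m n. \<phi> (m + n) = (\<Sum>u\<in>F. \<alpha> u m * \<beta> u n)"
  shows "lin_ext \<phi> (p * q) = (\<Sum>u\<in>F. lin_ext (\<alpha> u) p * lin_ext (\<beta> u) q)"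
proof (induction p rule: additive_induct)
  case (single m c)
  show ?case
  proof (induction q rule: additive_induct)
    case (single n d)
    show ?case
      by (simp add: mult_single assms smult_sum_right mult.commute)
  next
    case (add p q)
    then show ?case by (simp add: distrib_left sum.distrib)
  qed
next
  case (add p q)
  then show ?case by (simp add: distrib_right sum.distrib)
qed


section \<open>Quotients of subrings of a ring type\<close>

text \<open>
  For such rings, membership in an ideal and equality of cosets are statements about \<open>p - q\<close> in a
  type of class \<^class>\<open>ring_1\<close>, where ordinary algebraic simplification applies.
\<close>

locale concrete_ring =
  fixes S :: "'a::ring_1 set"
  assumes zero_mem: "0 \<in> S" and one_mem: "1 \<in> S"
    and add_mem: "\<And>x y. x \<in> S \<Longrightarrow> y \<in> S \<Longrightarrow> x + y \<in> S"
    and uminus_mem: "\<And>x. x \<in> S \<Longrightarrow> - x \<in> S"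
    and mult_mem: "\<And>x y. x \<in> S \<Longrightarrow> y \<in> S \<Longrightarrow> x * y \<in> S"
begin

lemma ring_on_simps:
  "carrier (ring_on S) = S" "x \<otimes>\<^bsub>ring_on S\<^esub> y = x * y" "\<one>\<^bsub>ring_on S\<^esub> = 1"
  "\<zero>\<^bsub>ring_on S\<^esub> = 0" "x \<oplus>\<^bsub>ring_on S\<^esub> y = x + y"
  by (simp_all add: ring_on_def)

lemma ring_ring_on: "ring (ring_on S)"
proof (rule ringI)
  show "abelian_group (ring_on S)"
    by (rule abelian_groupI)
      (auto simp: ring_on_simps zero_mem add_mem algebra_simps intro: bexI[OF _ uminus_mem])
  show "Group.monoid (ring_on S)"
    by (rule Group.monoidI) (auto simp: ring_on_simps one_mem mult_mem mult.assoc)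
qed (auto simp: ring_on_simps algebra_simps)

sublocale ring "ring_on S"
  by (rule ring_ring_on)

lemma diff_mem: "x \<in> S \<Longrightarrow> y \<in> S \<Longrightarrow> x - y \<in> S"
  using add_mem[of x "- y"] uminus_mem by simp

lemma sum_mem: "(\<And>x. x \<in> F \<Longrightarrow> f x \<in> S) \<Longrightarrow> sum f F \<in> S"
  by (induction F rule: infinite_finite_induct) (auto simp: zero_mem add_mem)

lemma a_inv_ring_on: "x \<in> S \<Longrightarrow> \<ominus>\<^bsub>ring_on S\<^esub> x = - x"
  by (rule minus_equality) (auto simp: ring_on_simps uminus_mem)

lemma ideal_ring_onI:
  assumes "K \<subseteq> S" "0 \<in> K" "\<And>x y. x \<in> K \<Longrightarrow> y \<in> K \<Longrightarrow> x + y \<in> K" "\<And>x. x \<in> K \<Longrightarrow> - x \<in> K"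
    "\<And>x a. x \<in> K \<Longrightarrow> a \<in> S \<Longrightarrow> a * x \<in> K" "\<And>x a. x \<in> K \<Longrightarrow> a \<in> S \<Longrightarrow> x * a \<in> K"
  shows "ideal K (ring_on S)"
proof (rule idealI[OF ring_ring_on])
  show "subgroup K (add_monoid (ring_on S))"
  proof (rule group.subgroupI)
    show "Group.group (add_monoid (ring_on S))" by (rule add.is_group)
    show "inv\<^bsub>add_monoid (ring_on S)\<^esub> a \<in> K" if "a \<in> K" for a
      using a_inv_ring_on[of a] that assms(1,4) by (auto simp: a_inv_def)
  qed (use assms in \<open>auto simp: ring_on_simps\<close>)
qed (use assms in \<open>auto simp: ring_on_simps\<close>)

end

locale concrete_quotient = concrete_ring S + ideal I "ring_on S" for S :: "'a::ring_1 set" and I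
begin

abbreviation coset :: "'a \<Rightarrow> 'a set" where
  "coset p \<equiv> I +>\<^bsub>ring_on S\<^esub> p"

lemma ideal_subset: "I \<subseteq> S"
  using a_subset by (simp add: ring_on_simps)

lemma ideal_zero: "0 \<in> I"
  using zero_closed by (simp add: ring_on_simps)

lemma ideal_add: "x \<in> I \<Longrightarrow> y \<in> I \<Longrightarrow> x + y \<in> I"
  using a_closed by (simp add: ring_on_simps)

lemma ideal_lmult: "x \<in> I \<Longrightarrow> a \<in> S \<Longrightarrow> a * x \<in> I"
  using I_l_closed by (simp add: ring_on_simps)

lemma ideal_rmult: "x \<in> I \<Longrightarrow> a \<in> S \<Longrightarrow> x * a \<in> I"
  using I_r_closed by (simp add: ring_on_simps)

lemma ideal_uminus: "x \<in> I \<Longrightarrow> - x \<in> I"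
  using ideal_lmult[of x "- 1"] uminus_mem[OF one_mem] by simp

lemma ideal_diff: "x \<in> I \<Longrightarrow> y \<in> I \<Longrightarrow> x - y \<in> I"
  using ideal_add[of x "- y"] ideal_uminus by simp

lemma ideal_sum: "(\<And>x. x \<in> F \<Longrightarrow> f x \<in> I) \<Longrightarrow> sum f F \<in> I"
  by (induction F rule: infinite_finite_induct) (auto simp: ideal_zero ideal_add)

lemma coset_conv: "coset p = (\<lambda>x. x + p) ` I"
  by (auto simp: a_r_coset_def r_coset_def ring_on_simps)

lemma coset_self: "p \<in> coset p"
  using ideal_zero by (force simp: coset_conv)

lemma mem_coset_iff: "q \<in> coset p \<longleftrightarrow> q - p \<in> I"
  by (force simp: coset_conv)

lemma coset_eq_iff: "coset p = coset q \<longleftrightarrow> p - q \<in> I"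
proof
  assume "coset p = coset q"
  then show "p - q \<in> I" using coset_self[of p] by (simp add: mem_coset_iff)
next
  assume pq: "p - q \<in> I"
  have "x - p \<in> I \<longleftrightarrow> x - q \<in> I" for x
    using ideal_add[OF _ pq, of "x - p"] ideal_diff[OF _ pq, of "x - q"] by auto
  then show "coset p = coset q" by (auto simp: mem_coset_iff)
qed

lemma carrier_quotient: "carrier (ring_on S Quot I) = coset ` S"
  by (auto simp: FactRing_def A_RCOSETS_def' ring_on_simps)

lemma quotient_simps:
  "\<one>\<^bsub>ring_on S Quot I\<^esub> = coset 1" "\<zero>\<^bsub>ring_on S Quot I\<^esub> = coset 0"
  "p \<in> S \<Longrightarrow> q \<in> S \<Longrightarrow> coset p \<otimes>\<^bsub>ring_on S Quot I\<^esub> coset q = coset (p * q)"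
  "p \<in> S \<Longrightarrow> q \<in> S \<Longrightarrow> coset p \<oplus>\<^bsub>ring_on S Quot I\<^esub> coset q = coset (p + q)"
  using ring_hom_mult[OF rcos_ring_hom] ring_hom_add[OF rcos_ring_hom]
    ring_hom_one[OF rcos_ring_hom] ring_hom_zero[OF rcos_ring_hom ring_ring_on quotient_is_ring]
  by (simp_all add: ring_on_simps)

end


section \<open>Particles hopping on a circle\<close>

abbreviation nx :: "nat \<Rightarrow> nat \<Rightarrow> nat" where
  "nx N j \<equiv> (j + 1) mod N"

definition hop :: "nat \<Rightarrow> nat \<Rightarrow> nat set \<Rightarrow> nat set option" where
  "hop N j S = (if j \<in> S \<and> nx N j \<notin> S then Some (insert (nx N j) (S - {j})) else None)"

text \<open>
  A word acts like a product of operators: its last letter comes first.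
\<close>

fun run :: "nat \<Rightarrow> nat list \<Rightarrow> nat set \<Rightarrow> nat set option" where
  "run N [] S = Some S"
| "run N (j # w) S = Option.bind (run N w S) (hop N j)"

lemma run_append: "run N (v @ w) S = Option.bind (run N w S) (run N v)"
  by (induction v) (auto simp: bind_assoc)

lemma hop_Some_iff:
  "hop N j S = Some T \<longleftrightarrow> j \<in> S \<and> nx N j \<notin> S \<and> T = insert (nx N j) (S - {j})"
  by (auto simp: hop_def)

lemma hop_None_iff: "hop N j S = None \<longleftrightarrow> j \<notin> S \<or> nx N j \<in> S"
  by (auto simp: hop_def)

lemma hop_subset: "hop N j S = Some T \<Longrightarrow> S \<subseteq> {..<N} \<Longrightarrow> N > 0 \<Longrightarrow> T \<subseteq> {..<N}"
  by (auto simp: hop_Some_iff)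

lemma run_subset: "run N w S = Some T \<Longrightarrow> S \<subseteq> {..<N} \<Longrightarrow> N > 0 \<Longrightarrow> T \<subseteq> {..<N}"
proof (induction w arbitrary: T)
  case (Cons j w)
  then obtain U where U: "run N w S = Some U" "hop N j U = Some T"
    by (auto simp: bind_eq_Some_conv)
  then show ?case using hop_subset[OF U(2)] Cons.IH[OF U(1)] Cons.prems(2,3) by simp
qed auto

lemma hop_card: "hop N j S = Some T \<Longrightarrow> finite S \<Longrightarrow> finite T \<and> card T = card S"
  using card_Suc_Diff1[of S j] by (auto simp: hop_Some_iff simp del: card_Diff_singleton)

lemma run_card: "run N w S = Some T \<Longrightarrow> finite S \<Longrightarrow> finite T \<and> card T = card S"
proof (induction w arbitrary: T)
  case (Cons j w)
  then obtain U where U: "run N w S = Some U" "hop N j U = Some T"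
    by (auto simp: bind_eq_Some_conv)
  then show ?case using hop_card[OF U(2)] Cons.IH[OF U(1)] Cons.prems(2) by simp
qed auto

lemma hop_inj: "hop N j S = Some T \<Longrightarrow> hop N j S' = Some T \<Longrightarrow> S = S'"
proof -
  have "S = insert j (T - {nx N j})" if "hop N j S = Some T" for S
    using that unfolding hop_Some_iff by blast
  then show "hop N j S = Some T \<Longrightarrow> hop N j S' = Some T \<Longrightarrow> S = S'" by metis
qed

lemma nx_inj: "i < N \<Longrightarrow> j < N \<Longrightarrow> nx N i = nx N j \<longleftrightarrow> i = j"
  by (auto simp: mod_Suc split: if_splits)

lemma nx_neq: "j < N \<Longrightarrow> N \<ge> 2 \<Longrightarrow> nx N j \<noteq> j"
  by (auto simp: mod_Suc split: if_splits)

lemma nx_surj: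
  assumes "i < N"
  obtains j where "j < N" "i = nx N j"
proof (cases i)
  case 0
  then show ?thesis using assms that[of "N - 1"] by simp
next
  case (Suc j)
  then show ?thesis using assms that[of j] by simp
qed

lemma cyclic_induct:
  assumes "i < N" "P i" "\<And>j. j < N \<Longrightarrow> P j \<Longrightarrow> P (nx N j)" "m < N"
  shows "P m"
proof -
  have *: "P ((i + d) mod N)" for d
  proof (induction d)
    case 0 then show ?case using assms(1,2) by simp
  next
    case (Suc d)
    then have "P (nx N ((i + d) mod N))" using assms(1) by (intro assms(3)) auto
    then show ?case by (simp add: mod_Suc_eq)
  qed
  have "(i + (m + N - i)) mod N = m" using assms(1,4) by simp
  then show ?thesis using *[of "m + N - i"] by metis
qed

text \<open>
  Conservation of particles at the place \<open>nx N j\<close>: the letter \<open>j\<close> puts a particle there, the letter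
  \<open>nx N j\<close> removes it, and no other letter affects it. Counting with naturals on both sides avoids
  subtraction.
\<close>

lemma run_count:
  assumes "run N w S = Some T" "set w \<subseteq> {..<N}" "N \<ge> 2" "j < N"
  shows "of_bool (nx N j \<in> T) + count_list w (nx N j) = of_bool (nx N j \<in> S) + count_list w j"
  using assms(1,2)
proof (induction w arbitrary: T)
  case Nil then show ?case by simp
next
  case (Cons i w)
  then obtain U where U: "run N w S = Some U" "hop N i U = Some T"
    by (auto simp: bind_eq_Some_conv)
  have i: "i < N" and IH: "of_bool (nx N j \<in> U) + count_list w (nx N j)
      = of_bool (nx N j \<in> S) + count_list w j"
    using Cons U by auto
  have eq: "nx N j = nx N i \<longleftrightarrow> j = i" by (rule nx_inj[OF assms(4) i])
  have ne: "nx N i \<noteq> i" "nx N j \<noteq> j" using nx_neq assms i by auto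
  show ?case using U(2) IH eq ne by (auto simp: hop_Some_iff)
qed

text \<open>
  The letters that affect a place act on it alternately, so the first of them to act (the rightmost
  one) decides whether the place was occupied at the start.
\<close>

lemma run_source_unique:
  assumes "run N w S \<noteq> None" "run N w S' \<noteq> None" "set w \<subseteq> {..<N}" "j < N" "N \<ge> 2"
    "j \<in> set w \<or> nx N j \<in> set w"
  shows "nx N j \<in> S \<longleftrightarrow> nx N j \<in> S'"
  using assms(1-3,6)
proof (induction w arbitrary: S S' rule: rev_induct)
  case (snoc i w)
  then obtain U U' where U: "hop N i S = Some U" "hop N i S' = Some U'"
      "run N w U \<noteq> None" "run N w U' \<noteq> None"
    by (auto simp: run_append bind_eq_Some_conv)
  have i: "i < N" and eq: "nx N j = nx N i \<longleftrightarrow> j = i"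
    using snoc.prems(3) nx_inj[OF assms(4)] by auto
  show ?case
  proof (cases "i = j \<or> i = nx N j")
    case True
    then show ?thesis using U(1,2) by (auto simp: hop_Some_iff)
  next
    case False
    then have "nx N j \<in> U \<longleftrightarrow> nx N j \<in> U'"
      using snoc.IH[OF U(3,4)] snoc.prems(3,4) by auto
    then show ?thesis using U(1,2) False eq by (auto simp: hop_Some_iff)
  qed
qed simp

lemma run_source_unique_full:
  assumes "run N w S \<noteq> None" "run N w S' \<noteq> None" "set w = {..<N}" "N \<ge> 2"
    "S \<subseteq> {..<N}" "S' \<subseteq> {..<N}"
  shows "S = S'"
proof -
  have "i \<in> S \<longleftrightarrow> i \<in> S'" if i: "i < N" for i
  proof -
    obtain j where "j < N" "i = nx N j" using nx_surj[OF i] by metis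
    then show ?thesis using run_source_unique[of N w S S' j] assms by auto
  qed
  then show ?thesis using assms(5,6) by blast
qed

text \<open>
  This repairs a configuration on which a further letter fails only because of places that the word
  never looked at.
\<close>

lemma run_change_untouched:
  assumes "run N w S = Some T" "x \<notin> set w" "\<And>j. j \<in> set w \<Longrightarrow> nx N j \<noteq> x"
  shows "run N w (insert x S) = Some (insert x T)" "run N w (S - {x}) = Some (T - {x})"
proof -
  have "run N w (insert x S) = Some (insert x T) \<and> run N w (S - {x}) = Some (T - {x})"
    using assms
  proof (induction w arbitrary: T)
    case (Cons j w)
    then obtain U where U: "run N w S = Some U" "hop N j U = Some T"
      by (auto simp: bind_eq_Some_conv)
    have "hop N j (insert x U) = Some (insert x T)" "hop N j (U - {x}) = Some (T - {x})"
      using U(2) Cons.prems(2,3) by (auto simp: hop_Some_iff)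
    moreover have "run N w (insert x S) = Some (insert x U) \<and> run N w (S - {x}) = Some (U - {x})"
      using Cons U by auto
    ultimately show ?case by auto
  qed auto
  then show "run N w (insert x S) = Some (insert x T)" "run N w (S - {x}) = Some (T - {x})"
    by simp_all
qed

text \<open>Two hops out of the same position need a hop into it in between, and conversely.\<close>

lemma run_no_repeat:
  assumes "run N (x @ y) S \<noteq> None" "set x \<subseteq> {..<N}" "i < N" "N \<ge> 2"
  shows "i \<notin> set x \<Longrightarrow> count_list x (nx N i) \<le> 1"
    and "nx N i \<notin> set x \<Longrightarrow> count_list x i \<le> 1"
proof -
  obtain U T where "run N x U = Some T"
    using assms(1) by (auto simp: run_append bind_eq_Some_conv)
  from run_count[OF this assms(2,4,3)]
  have *: "of_bool (nx N i \<in> T) + count_list x (nx N i) = of_bool (nx N i \<in> U) + count_list x i" .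
  have le: "of_bool (nx N i \<in> T) \<le> (1::nat)" "of_bool (nx N i \<in> U) \<le> (1::nat)" by auto
  show "count_list x (nx N i) \<le> 1" if "i \<notin> set x"
  proof -
    have "count_list x i = 0" using that by (simp add: count_list_0_iff)
    then show ?thesis using * le by linarith
  qed
  show "count_list x i \<le> 1" if "nx N i \<notin> set x"
  proof -
    have "count_list x (nx N i) = 0" using that by (simp add: count_list_0_iff)
    then show ?thesis using * le by linarith
  qed
qed

text \<open>
  If every letter occurs at most once, the configuration in front of each hop can be read off
  from the letters already used.
\<close>

lemma run_distinct:
  assumes "distinct w" "set w \<subseteq> {..<N}" "N \<ge> 2"
    and avail: "\<And>u j v. w = u @ j # v \<Longrightarrow> j \<in> S \<or> (\<exists>i\<in>set v. nx N i = j)"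
    and free: "\<And>u j v. w = u @ j # v \<Longrightarrow> nx N j \<notin> S \<or> nx N j \<in> set v"
  shows "run N w S \<noteq> None"
  using assms(1,2,4,5)
proof (induction w)
  case (Cons j v)
  have "run N v S \<noteq> None"
  proof (rule Cons.IH)
    fix u i x assume "v = u @ i # x"
    then have "j # v = (j # u) @ i # x" by simp
    then show "i \<in> S \<or> (\<exists>i'\<in>set x. nx N i' = i)" "nx N i \<notin> S \<or> nx N i \<in> set x"
      using Cons.prems(3,4) by blast+
  qed (use Cons.prems in auto)
  then obtain T where T: "run N v S = Some T" by auto
  have v: "set v \<subseteq> {..<N}" and j: "j < N" and jv: "j \<notin> set v" using Cons.prems by auto
  obtain i where i: "i < N" "j = nx N i" using nx_surj[OF j] by metis
  have "i \<in> set v" if "j \<notin> S"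
    using Cons.prems(3)[of "[]" j v] that i nx_inj v by (metis append_Nil lessThan_iff subsetD)
  moreover have "of_bool (j \<in> T) + count_list v j = of_bool (j \<in> S) + count_list v i"
    using run_count[OF T v assms(3) i(1)] i by simp
  moreover have "count_list v i \<noteq> 0 \<longleftrightarrow> i \<in> set v" "count_list v j = 0"
    using jv by (auto simp: count_list_0_iff)
  ultimately have 1: "j \<in> T" by (cases "j \<in> S"; cases "j \<in> T"; simp)
  have "of_bool (nx N j \<in> T) + count_list v (nx N j) = of_bool (nx N j \<in> S) + count_list v j"
    by (rule run_count[OF T v assms(3) j])
  moreover have "nx N j \<in> S \<Longrightarrow> nx N j \<in> set v" using Cons.prems(4)[of "[]" j v] by auto
  moreover have "count_list v (nx N j) \<noteq> 0 \<longleftrightarrow> nx N j \<in> set v" "count_list v j = 0"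
    using jv by (auto simp: count_list_0_iff)
  ultimately have 2: "nx N j \<notin> T" by (cases "nx N j \<in> S"; cases "nx N j \<in> T"; simp)
  show ?case using T 1 2 by (auto simp: hop_def)
qed simp

text \<open>
  In a closed run, the flow of particles through all places is the same.
\<close>

lemma run_balanced:
  assumes "run N w S = Some S" "set w \<subseteq> {..<N}" "N \<ge> 2" "i < N"
  shows "count_list w i = count_list w 0"
proof (rule cyclic_induct[where P = "\<lambda>i. count_list w i = count_list w 0" and i = 0])
  show "count_list w (nx N j) = count_list w 0" if "j < N" "count_list w j = count_list w 0" for j
    using run_count[OF assms(1-3) that(1)] that(2) by simp
  show "0 < N" using assms(3) by simp
qed (simp_all add: assms(4))

text \<open>
  By conservation, the source and the target determine the differences between the counts of
  consecutive letters, so a single count determines all of them.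
\<close>

lemma run_counts_unique:
  assumes "run N w S = Some T" "run N w' S = Some T" "set w \<subseteq> {..<N}" "set w' \<subseteq> {..<N}" "N \<ge> 2"
    "count_list w 0 = count_list w' 0" "i < N"
  shows "count_list w i = count_list w' i"
proof (rule cyclic_induct[where P = "\<lambda>i. count_list w i = count_list w' i" and i = 0])
  show "count_list w (nx N j) = count_list w' (nx N j)"
    if "j < N" "count_list w j = count_list w' j" for j
    using run_count[OF assms(1,3,5) that(1)] run_count[OF assms(2,4,5) that(1)] that(2) by simp
  show "0 < N" using assms(5) by simp
qed (simp_all add: assms(6,7))


section \<open>The representation on configurations is faithful\<close>

text \<open>
  The variable \<open>q\<close> records the hops out of the place \<open>0\<close>. By \<open>run_counts_unique\<close>, this exponent
  together with source and target determines the whole multidegree of a word, so one variable is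
  enough for a faithful representation.
\<close>

definition entry :: "nat \<Rightarrow> nat set \<Rightarrow> nat set \<Rightarrow> word \<Rightarrow> 'k::field poly" where
  "entry N T S w = (if run N (letters w) S = Some T
     then Polynomial.monom 1 (count_list (letters w) 0) else 0)"

definition mat :: "nat \<Rightarrow> (word \<Rightarrow>\<^sub>0 'k::field) \<Rightarrow> nat set \<Rightarrow> nat set \<Rightarrow> 'k poly" where
  "mat N p T S = lin_ext (entry N T S) p"

lemma entry_add:
  assumes "S \<subseteq> {..<N}" "N > 0"
  shows "entry N T S (v + w) = (\<Sum>U\<in>Pow {..<N}. entry N T U v * entry N U S w)"
proof (cases "run N (letters w) S")
  case None
  then show ?thesis by (simp add: entry_def plus_word_def run_append)
next
  case (Some U)
  have "U \<in> Pow {..<N}" using run_subset[OF Some assms] by simp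
  then have "(\<Sum>U'\<in>Pow {..<N}. entry N T U' v * entry N U' S w)
      = (entry N T U v * Polynomial.monom 1 (count_list (letters w) 0) :: 'a poly)"
    using Some by (simp add: entry_def if_distrib[of "\<lambda>x. _ * x"] sum.delta cong: if_cong)
  then show ?thesis using Some by (simp add: entry_def plus_word_def run_append mult_monom)
qed

lemma mat_mult:
  assumes "S \<subseteq> {..<N}" "N > 0"
  shows "mat N (p * q) T S = (\<Sum>U\<in>Pow {..<N}. mat N p T U * mat N q U S)"
  unfolding mat_def by (rule lin_ext_mult) (rule entry_add[OF assms])

lemma mat_simps [simp]:
  "mat N 0 T S = 0" "mat N (p + q) T S = mat N p T S + mat N q T S"
  "mat N (- p) T S = - mat N p T S" "mat N (p - q) T S = mat N p T S - mat N q T S"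
  "mat N (Poly_Mapping.single w c) T S = smult c (entry N T S w)"
  by (simp_all add: mat_def)

lemma mat_scalar: "mat N (Poly_Mapping.single 0 c) T S = (if S = T then [:c:] else 0)"
  by (simp add: entry_def zero_word_def monom_0)

lemma single_sum:
  "Poly_Mapping.single m (\<Sum>x\<in>F. f x) = (\<Sum>x\<in>F. Poly_Mapping.single m (f x))"
  by (induction F rule: infinite_finite_induct) (auto simp: single_add)

definition words_alg :: "nat \<Rightarrow> (word \<Rightarrow>\<^sub>0 'k::field) set" where
  "words_alg N = {p. \<forall>w\<in>Poly_Mapping.keys p. set (letters w) \<subseteq> {..<N}}"

lemma free_alg_conv: "free_alg N = ring_on (words_alg N)"
  by (simp add: free_alg_def words_alg_def)

lemma single_mem_words_alg:
  "set (letters w) \<subseteq> {..<N} \<Longrightarrow> Poly_Mapping.single w c \<in> words_alg N"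
  by (auto simp: words_alg_def)

lemma concrete_ring_words_alg: "concrete_ring (words_alg N :: (word \<Rightarrow>\<^sub>0 'k::field) set)"
proof
  fix p q :: "word \<Rightarrow>\<^sub>0 'k" assume "p \<in> words_alg N" and "q \<in> words_alg N"
  then show "p + q \<in> words_alg N"
    using Poly_Mapping.keys_add[of p q] by (auto simp: words_alg_def)
  show "p * q \<in> words_alg N"
    using keys_mult[of p q] \<open>p \<in> words_alg N\<close> \<open>q \<in> words_alg N\<close>
    by (fastforce simp: words_alg_def plus_word_def)
qed (auto simp: words_alg_def in_keys_iff zero_word_def lookup_one when_def)

lemma nTL_rels_subset:
  assumes "N > 0"
  shows "nTL_rels N \<subseteq> words_alg N"
proof -
  interpret concrete_ring "words_alg N" by (rule concrete_ring_words_alg)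
  have gen: "free_gen N i \<in> words_alg N" for i
    using assms by (auto simp: free_gen_def intro!: single_mem_words_alg)
  show ?thesis by (auto simp: nTL_rels_def Let_def intro!: gen mult_mem diff_mem)
qed

lemma concrete_quotient_nTL:
  assumes "N > 0"
  shows "concrete_quotient (words_alg N) (nTL_ideal N)"
proof -
  interpret concrete_ring "words_alg N" by (rule concrete_ring_words_alg)
  have "ideal (nTL_ideal N) (ring_on (words_alg N))"
    unfolding nTL_ideal_def free_alg_conv
    by (rule genideal_ideal) (simp add: ring_on_simps nTL_rels_subset assms)
  then show ?thesis by (intro concrete_quotient.intro concrete_ring_words_alg)
qed

text \<open>
  The ideal is a parameter in order to fix the field \<open>'k\<close> throughout the locale.
\<close>

locale affine_nTL =
  fixes N :: nat and I :: "(word \<Rightarrow>\<^sub>0 'k::field) set"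
  assumes N: "N \<ge> 3" and I_def: "I = nTL_ideal N"
begin

sublocale concrete_quotient "words_alg N" I
  unfolding I_def using N by (intro concrete_quotient_nTL) simp

abbreviation wd :: "nat list \<Rightarrow> (word \<Rightarrow>\<^sub>0 'k)" where
  "wd w \<equiv> Poly_Mapping.single (Word w) 1"

lemma wd_append: "wd (v @ w) = wd v * wd w"
  by (simp add: mult_single plus_word_def)

lemma wd_Cons: "wd (j # w) = wd [j] * wd w"
  using wd_append[of "[j]" w] by simp

lemma wd_mem: "set w \<subseteq> {..<N} \<Longrightarrow> wd w \<in> words_alg N"
  by (simp add: single_mem_words_alg)

lemma rels_in_ideal: "x \<in> nTL_rels N \<Longrightarrow> x \<in> I"
  using genideal_self[of "nTL_rels N"] nTL_rels_subset[of N] N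
  by (auto simp: I_def nTL_ideal_def free_alg_conv ring_on_simps)

lemma square_in_ideal:
  assumes "i < N"
  shows "wd [i, i] \<in> I"
proof (rule rels_in_ideal)
  have "wd [i, i] = free_gen N i * free_gen N i"
    using assms by (simp add: free_gen_def mult_single plus_word_def)
  then show "wd [i, i] \<in> nTL_rels N"
    using assms unfolding nTL_rels_def Let_def by blast
qed

lemma braid_in_ideal:
  assumes "i < N"
  shows "wd [i, nx N i, i] \<in> I"
proof (rule rels_in_ideal)
  have "wd [i, nx N i, i] = free_gen N i * free_gen N (i + 1) * free_gen N i"
    using assms by (simp add: free_gen_def mult_single plus_word_def)
  then show "wd [i, nx N i, i] \<in> nTL_rels N"
    using assms unfolding nTL_rels_def Let_def by blast
qed

lemma braid_in_ideal':
  assumes "i < N"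
  shows "wd [nx N i, i, nx N i] \<in> I"
proof (rule rels_in_ideal)
  have "wd [nx N i, i, nx N i] = free_gen N (i + 1) * free_gen N i * free_gen N (i + 1)"
    using assms by (simp add: free_gen_def mult_single plus_word_def)
  then show "wd [nx N i, i, nx N i] \<in> nTL_rels N"
    using assms unfolding nTL_rels_def Let_def by blast
qed

lemma swap_in_ideal:
  assumes "i < N" "j < N" "nx N i \<noteq> j" "nx N j \<noteq> i"
  shows "wd [i, j] - wd [j, i] \<in> I"
proof (rule rels_in_ideal)
  have "wd [i, j] - wd [j, i] = free_gen N i * free_gen N j - free_gen N j * free_gen N i"
    using assms by (simp add: free_gen_def mult_single plus_word_def)
  then show "wd [i, j] - wd [j, i] \<in> nTL_rels N"
    using assms unfolding nTL_rels_def Let_def by blast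
qed

text \<open>
  The relations hold for operators: after \<open>i\<close> has acted, place \<open>i\<close> is empty and place \<open>nx N i\<close> is
  occupied, so \<open>i\<close> cannot act again before both neighbouring letters have acted. Distinct
  letters that are not neighbours affect disjoint pairs of places.
\<close>

lemma mat_ideal:
  assumes "p \<in> I" "S \<subseteq> {..<N}"
  shows "mat N p T S = 0"
proof -
  let ?K = "{p \<in> words_alg N. \<forall>T S. S \<subseteq> {..<N} \<longrightarrow> mat N p T S = (0 :: 'k poly)}"
  have K: "ideal ?K (ring_on (words_alg N))"
    by (rule ideal_ring_onI) (use N in \<open>auto simp: zero_mem add_mem uminus_mem mult_mem mat_mult\<close>)
  have gen: "mat N r T S = 0" if "r \<in> nTL_rels N" "S \<subseteq> {..<N}" for r :: "word \<Rightarrow>\<^sub>0 'k" and T S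
  proof -
    have ne: "nx N (nx N i) \<noteq> i" "nx N i \<noteq> i" if "i < N" for i
      using that N by (auto simp: mod_Suc split: if_splits)
    have sq: "run N [i, i] S = None" if "i < N" for i
      using ne[OF that] by (auto simp: hop_def split: bind_splits)
    have br: "run N [i, nx N i, i] S = None" "run N [nx N i, i, nx N i] S = None" if "i < N" for i
      using ne[OF that] by (auto simp: hop_def split: bind_splits)
    have sw: "run N [i, j] S = run N [j, i] S" "count_list [i, j] 0 = count_list [j, i] 0"
      if "i < N" "j < N" "nx N i \<noteq> j" "nx N j \<noteq> i" for i j
      using that nx_inj[OF that(1,2)] by (auto simp: hop_def split: bind_splits)
    from \<open>r \<in> nTL_rels N\<close> consider
        i where "i < N" "r = wd [i, i]"
      | i j where "i < N" "j < N" "nx N i \<noteq> j" "nx N j \<noteq> i" "r = wd [i, j] - wd [j, i]"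
      | i where "i < N" "r = wd [i, nx N i, i]" | i where "i < N" "r = wd [nx N i, i, nx N i]"
      by (auto simp: nTL_rels_def Let_def free_gen_def mult_single plus_word_def)
    then show ?thesis
    proof cases
      case 1 then show ?thesis using sq[of i] by (simp add: entry_def del: run.simps)
    next
      case 2 then show ?thesis
        using sw[of i j] by (simp add: entry_def del: run.simps count_list.simps)
    next
      case 3 then show ?thesis using br(1)[of i] by (simp add: entry_def del: run.simps)
    next
      case 4 then show ?thesis using br(2)[of i] by (simp add: entry_def del: run.simps)
    qed
  qed
  have "I \<subseteq> ?K"
    unfolding I_def nTL_ideal_def free_alg_conv
    using nTL_rels_subset[of N] N by (intro genideal_minimal K) (auto simp: gen)
  then show ?thesis using assms by blast
qed

lemma move_letter:
  assumes "i < N" "set y \<subseteq> {..<N}" "\<And>j. j \<in> set y \<Longrightarrow> nx N i \<noteq> j \<and> nx N j \<noteq> i"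
  shows "wd (y @ [i]) - wd (i # y) \<in> I"
  using assms(2,3)
proof (induction y)
  case Nil then show ?case by (simp add: ideal_zero)
next
  case (Cons j y)
  have "wd ((j # y) @ [i]) - wd (i # j # y)
      = wd [j] * (wd (y @ [i]) - wd (i # y)) + (wd [j, i] - wd [i, j]) * wd y"
    by (simp add: algebra_simps wd_append[symmetric] del: single_diff)
  moreover have "wd [j, i] - wd [i, j] \<in> I"
    using Cons.prems assms(1) by (intro swap_in_ideal) auto
  moreover have "wd (y @ [i]) - wd (i # y) \<in> I"
    using Cons by auto
  ultimately show ?case
    using Cons.prems ideal_add[OF ideal_lmult ideal_rmult] wd_mem by auto
qed

lemma ideal_context:
  assumes "wd u \<in> I" "set x \<subseteq> {..<N}" "set z \<subseteq> {..<N}"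
  shows "wd (x @ u @ z) \<in> I"
  unfolding wd_append by (intro ideal_lmult ideal_rmult wd_mem assms)

lemma ideal_diff_context:
  assumes "wd u - wd u' \<in> I" "set x \<subseteq> {..<N}" "set z \<subseteq> {..<N}"
  shows "wd (x @ u @ z) - wd (x @ u' @ z) \<in> I"
proof -
  have "wd (x @ u @ z) - wd (x @ u' @ z) = wd x * (wd u - wd u') * wd z"
    by (simp add: wd_append algebra_simps)
  then show ?thesis
    using ideal_rmult[OF ideal_lmult] assms wd_mem by metis
qed

lemma ideal_eqv: "x - y \<in> I \<Longrightarrow> y \<in> I \<Longrightarrow> x \<in> I"
  using ideal_add[of "x - y" y] by simp

text \<open>
  All letters of \<open>x\<close> except possibly one neighbour \<open>n\<close> of \<open>i\<close> commute with \<open>i\<close>, so the two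
  occurrences of \<open>i\<close> can be moved together to \<open>i i\<close> or to \<open>i n i\<close>.
\<close>

lemma sandwich_in_ideal:
  assumes "i < N" "set x \<subseteq> {..<N}" "i \<notin> set x"
    and "n < N" "n = nx N i \<or> nx N n = i" "count_list x n \<le> 1"
    and nonadj: "\<And>j. j \<in> set x \<Longrightarrow> j \<noteq> n \<Longrightarrow> nx N i \<noteq> j \<and> nx N j \<noteq> i"
  shows "wd (i # x @ [i]) \<in> I"
proof -
  have mv: "wd (y @ [i]) - wd (i # y) \<in> I" if "set y \<subseteq> set x - {n}" for y
    by (rule move_letter[OF assms(1)]) (use that assms(2) nonadj in blast)+
  show ?thesis
  proof (cases "n \<in> set x")
    case False
    have "wd ([i] @ (x @ [i]) @ []) - wd ([i] @ (i # x) @ []) \<in> I"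
      using assms(1) False by (intro ideal_diff_context mv) auto
    moreover have "wd ([] @ [i, i] @ x) \<in> I"
      using assms(1,2) by (intro ideal_context square_in_ideal) auto
    ultimately show ?thesis using ideal_eqv by auto
  next
    case True
    then obtain a b where x: "x = a @ n # b" by (meson split_list)
    with assms(6) have ab: "n \<notin> set a" "n \<notin> set b" by (auto simp: count_list_0_iff[symmetric])
    have sub: "set a \<subseteq> {..<N}" "set b \<subseteq> {..<N}" "set a \<subseteq> set x - {n}" "set b \<subseteq> set x - {n}"
      using assms(2) ab x by auto
    have inin: "wd [i, n, i] \<in> I"
      using assms(1,4,5) braid_in_ideal[of i] braid_in_ideal'[of n] by auto
    have 1: "wd ((i # a @ [n]) @ (b @ [i]) @ []) - wd ((i # a @ [n]) @ (i # b) @ []) \<in> I"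
      using assms(1,4) sub by (intro ideal_diff_context mv) auto
    have 2: "wd ([] @ (a @ [i]) @ (n # i # b)) - wd ([] @ (i # a) @ (n # i # b)) \<in> I"
      using assms(1,4) sub by (intro ideal_diff_context mv) auto
    have 3: "wd (a @ [i, n, i] @ b) \<in> I"
      using sub by (intro ideal_context inin) auto
    have "wd (i # a @ n # i # b) \<in> I"
      using ideal_diff[OF 3 2] by simp
    then show ?thesis using 1 ideal_eqv x by auto
  qed
qed

text \<open>
  Suppose that place \<open>i\<close> is empty after \<open>u\<close> although \<open>u\<close> affects it. Then the last letter of \<open>u\<close> to
  affect it is \<open>i\<close> itself. Since that moment neither \<open>i\<close> nor its predecessor has acted, and the
  successor of \<open>i\<close> at most once, because acting twice would need another hop into its place. The case
  that place \<open>nx N i\<close> is occupied is symmetric. Hence \<open>i u\<close> contains a factor as in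
  \<open>sandwich_in_ideal\<close>.
\<close>

lemma blocked_in_ideal:
  assumes "run N u S = Some T" "i < N" "set u \<subseteq> {..<N}"
    and "i \<notin> T \<and> (\<exists>j\<in>set u. j = i \<or> nx N j = i)
      \<or> nx N i \<in> T \<and> (\<exists>j\<in>set u. j = i \<or> j = nx N i)"
  shows "wd (i # u) \<in> I"
proof -
  obtain p where p: "p < N" "i = nx N p" using nx_surj[OF assms(2)] by metis
  have ne: "nx N i \<noteq> i" "p \<noteq> i" "nx N i \<noteq> p"
    using p N by (auto simp: mod_Suc split: if_splits)
  have adj: "nx N j = i \<longleftrightarrow> j = p" if "j < N" for j
    using nx_inj[OF that p(1)] p(2) by simp
  from assms(4) have "\<exists>n\<in>{p, nx N i}. \<exists>x y. u = x @ i # y \<and> i \<notin> set x \<and> count_list x n \<le> 1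
      \<and> (\<forall>j\<in>set x. j \<noteq> n \<longrightarrow> nx N i \<noteq> j \<and> nx N j \<noteq> i)"
  proof
    assume a: "i \<notin> T \<and> (\<exists>j\<in>set u. j = i \<or> nx N j = i)"
    then obtain x c y where u: "u = x @ c # y" "c = i \<or> nx N c = i"
        and x: "\<forall>j\<in>set x. \<not> (j = i \<or> nx N j = i)"
      using split_list_first_prop[of u "\<lambda>j. j = i \<or> nx N j = i"] by blast
    have px: "p \<notin> set x" using x p by auto
    obtain V U where V: "run N y S = Some V" "hop N c V = Some U" "run N x U = Some T"
      using assms(1) u by (auto simp: run_append bind_eq_Some_conv)
    have "of_bool (nx N p \<in> T) + count_list x (nx N p) = of_bool (nx N p \<in> U) + count_list x p"
      using run_count[OF V(3) _ _ p(1)] assms(3) N u by auto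
    then have "i \<notin> U" using a px x p by (auto simp: count_list_0_iff)
    then have c: "c = i" using V(2) u(2) by (auto simp: hop_Some_iff)
    have "count_list x (nx N i) \<le> 1"
      using assms u x N by (intro run_no_repeat(1)[of N x "c # y" S i]) auto
    then show ?thesis using u(1) c x by blast
  next
    assume a: "nx N i \<in> T \<and> (\<exists>j\<in>set u. j = i \<or> j = nx N i)"
    then obtain x c y where u: "u = x @ c # y" "c = i \<or> c = nx N i"
        and x: "\<forall>j\<in>set x. \<not> (j = i \<or> j = nx N i)"
      using split_list_first_prop[of u "\<lambda>j. j = i \<or> j = nx N i"] by blast
    obtain V U where V: "run N y S = Some V" "hop N c V = Some U" "run N x U = Some T"
      using assms(1) u by (auto simp: run_append bind_eq_Some_conv)
    have "of_bool (nx N i \<in> T) + count_list x (nx N i) = of_bool (nx N i \<in> U) + count_list x i"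
      using run_count[OF V(3) _ _ assms(2)] assms(3) N u by auto
    then have "nx N i \<in> U" using a x by (cases "nx N i \<in> U") (auto simp: count_list_0_iff)
    then have c: "c = i" using V(2) u(2) nx_neq[of "nx N i" N] N by (auto simp: hop_Some_iff)
    have "count_list x p \<le> 1"
      using assms u x N p by (intro run_no_repeat(2)[of N x "c # y" S p]) auto
    moreover have "\<forall>j\<in>set x. j \<noteq> p \<longrightarrow> nx N i \<noteq> j \<and> nx N j \<noteq> i"
      using x assms(3) u(1) adj by auto
    ultimately show ?thesis using u(1) c x by blast
  qed
  then obtain n x y where n: "n = p \<or> n = nx N i" "u = x @ i # y" "i \<notin> set x"
      "count_list x n \<le> 1" "\<forall>j\<in>set x. j \<noteq> n \<longrightarrow> nx N i \<noteq> j \<and> nx N j \<noteq> i"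
    by blast
  have "wd (i # x @ [i]) \<in> I"
    by (rule sandwich_in_ideal[where n = n]) (use n assms p N in auto)
  then have "wd ([] @ (i # x @ [i]) @ y) \<in> I"
    using assms(3) n by (intro ideal_context) auto
  then show ?thesis using n by simp
qed

text \<open>
  In a minimal counterexample \<open>i u\<close>, the word \<open>u\<close> acts on some configuration. The obstacles for \<open>i\<close>
  are not of the kind in \<open>blocked_in_ideal\<close>, so they sit at places that \<open>u\<close> never affects and can
  be removed from the source.
\<close>

lemma run_None_in_ideal:
  assumes "set w \<subseteq> {..<N}" "\<And>S. S \<subseteq> {..<N} \<Longrightarrow> run N w S = None"
  shows "wd w \<in> I"
  using assms
proof (induction w)
  case Nil then show ?case by auto
next
  case (Cons i u)
  have i: "i < N" and u: "set u \<subseteq> {..<N}" using Cons.prems(1) by auto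
  show ?case
  proof (rule ccontr)
    assume not: "wd (i # u) \<notin> I"
    then have "wd u \<notin> I"
      using ideal_lmult[OF _ wd_mem[of "[i]"], of "wd u"] i by (auto simp only: wd_Cons[of i u] set_simps)
    then obtain S T where S: "S \<subseteq> {..<N}" "run N u S = Some T" using Cons.IH[OF u] by (metis not_None_eq)
    obtain S1 T1 where S1: "S1 \<subseteq> {..<N}" "run N u S1 = Some T1" "i \<in> T1"
    proof (cases "i \<in> T")
      case True then show ?thesis using S that by blast
    next
      case False
      then have "\<not> (\<exists>j\<in>set u. j = i \<or> nx N j = i)"
        using blocked_in_ideal[OF S(2) i u] not by blast
      then have "run N u (insert i S) = Some (insert i T)"
        by (intro run_change_untouched(1) S) auto
      then show ?thesis using S i that[of "insert i S"] by auto
    qed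
    obtain S2 T2 where S2: "S2 \<subseteq> {..<N}" "run N u S2 = Some T2" "i \<in> T2" "nx N i \<notin> T2"
    proof (cases "nx N i \<in> T1")
      case False then show ?thesis using S1 that by blast
    next
      case True
      then have "\<not> (\<exists>j\<in>set u. j = i \<or> j = nx N i)"
        using blocked_in_ideal[OF S1(2) i u] not by blast
      then have "run N u (S1 - {nx N i}) = Some (T1 - {nx N i})"
        using u nx_inj i by (intro run_change_untouched(2) S1) (auto simp: subset_iff)
      moreover have "nx N i \<noteq> i" using nx_neq[OF i] N by simp
      ultimately show ?thesis
        using S1 by (intro that[of "S1 - {nx N i}" "T1 - {nx N i}"]) auto
    qed
    then show False using Cons.prems(2)[OF S2(1)] by (simp add: hop_None_iff)
  qed
qed

text \<open>
  Let \<open>i\<close> be the first letter of \<open>w\<close> to act, so that place \<open>i\<close> is occupied in \<open>S\<close> and the next one is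
  free. In \<open>w'\<close>, no neighbour of \<open>i\<close> can act before the first \<open>i\<close> does, so this \<open>i\<close> can be commuted
  to the right end, and induction applies to the remaining words.
\<close>

lemma same_counts_eqv:
  assumes "run N w S = Some T" "run N w' S = Some T" "set w \<subseteq> {..<N}" "set w' \<subseteq> {..<N}"
    "\<And>i. count_list w i = count_list w' i" "S \<subseteq> {..<N}"
  shows "wd w - wd w' \<in> I"
  using assms
proof (induction w arbitrary: w' S rule: rev_induct)
  case Nil
  have "i \<notin> set w'" for i using Nil.prems(5)[of i] by (simp add: count_list_0_iff[symmetric])
  then have "w' = []" by (metis list.set_intros(1) neq_Nil_conv)
  then show ?case by (simp add: ideal_zero)
next
  case (snoc i u)
  have i: "i < N" using snoc.prems by simp
  obtain S1 where S1: "hop N i S = Some S1" "run N u S1 = Some T"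
    using snoc.prems(1) by (auto simp: run_append bind_eq_Some_conv)
  have iS: "i \<in> S" "nx N i \<notin> S" using S1 by (auto simp: hop_Some_iff)
  have "count_list w' i \<noteq> 0" using snoc.prems(5)[of i] by simp
  then have "i \<in> set w'" by (simp add: count_list_0_iff)
  then obtain x y where w': "w' = x @ i # y" "i \<notin> set y" by (meson split_list_last)
  have xy: "set x \<subseteq> {..<N}" "set y \<subseteq> {..<N}" using snoc.prems(4) w' by auto
  obtain U where U: "run N y S = Some U" "i \<in> U" "nx N i \<notin> U"
    using snoc.prems(2) w' by (auto simp: run_append bind_eq_Some_conv hop_Some_iff)
  obtain p where p: "p < N" "i = nx N p" using nx_surj[OF i] by metis
  have N2: "N \<ge> 2" using N by simp
  have "count_list y p = 0"
    using run_count[OF U(1) xy(2) N2 p(1)] U(2) iS(1) w'(2) p(2) by (simp add: count_list_0_iff)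
  moreover have "count_list y (nx N i) = 0"
    using run_count[OF U(1) xy(2) N2 i] U(3) iS(2) w'(2) by (simp add: count_list_0_iff)
  ultimately have "p \<notin> set y" "nx N i \<notin> set y" by (simp_all add: count_list_0_iff)
  then have "nx N i \<noteq> j \<and> nx N j \<noteq> i" if "j \<in> set y" for j
    using that xy p nx_inj[of j N p] by auto
  then have "wd (y @ [i]) - wd (i # y) \<in> I"
    using i xy by (intro move_letter) auto
  then have eqv: "wd (x @ (y @ [i]) @ []) - wd (x @ (i # y) @ []) \<in> I"
    using xy by (intro ideal_diff_context) auto
  then have "entry N T S (Word (x @ (y @ [i]) @ [])) = (entry N T S (Word w') :: 'k poly)"
    using mat_ideal[OF eqv snoc.prems(6), of T] w' by simp
  then have "run N (x @ y @ [i]) S = Some T"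
    using snoc.prems(2) by (auto simp: entry_def split: if_splits)
  then have "run N (x @ y) S1 = Some T" using S1(1) by (simp add: run_append)
  moreover have "count_list u j = count_list (x @ y) j" for j
    using snoc.prems(5)[of j] w' by (auto split: if_splits)
  moreover have "S1 \<subseteq> {..<N}" using hop_subset[OF S1(1) snoc.prems(6)] N by simp
  ultimately have "wd u - wd (x @ y) \<in> I"
    using S1(2) snoc.prems(3) xy by (intro snoc.IH) auto
  then have "wd ([] @ u @ [i]) - wd ([] @ (x @ y) @ [i]) \<in> I"
    using i by (intro ideal_diff_context) auto
  from ideal_add[OF this eqv] show ?case using w' by simp
qed

text \<open>
  The keys of \<open>p\<close> that contribute to one coefficient of one matrix entry represent the same element
  of the quotient by \<open>same_counts_eqv\<close>, and their coefficients add up to \<open>0\<close>. Hence this part of \<open>p\<close>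
  lies in the ideal and can be removed; a key that contributes to no entry is in the ideal itself.
\<close>

theorem mat_faithful:
  assumes "p \<in> words_alg N" "\<And>T S. T \<subseteq> {..<N} \<Longrightarrow> S \<subseteq> {..<N} \<Longrightarrow> mat N p T S = 0"
  shows "p \<in> I"
  using assms
proof (induction "card (Poly_Mapping.keys p)" arbitrary: p rule: less_induct)
  case less
  show ?case
  proof (cases "p = 0")
    case True then show ?thesis by (simp add: ideal_zero)
  next
    case False
    then obtain w where w: "w \<in> Poly_Mapping.keys p"
      using keys_eq_empty[of p] by blast
    have wN: "set (letters v) \<subseteq> {..<N}" if "v \<in> Poly_Mapping.keys p" for v
      using that less.prems(1) by (auto simp: words_alg_def)
    \<comment> \<open>a set of keys containing \<open>w\<close> whose part of \<open>p\<close> lies in the ideal\<close>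
    obtain K where K: "K \<subseteq> Poly_Mapping.keys p" "w \<in> K"
      "(\<Sum>v\<in>K. Poly_Mapping.single v (Poly_Mapping.lookup p v)) \<in> I"
    proof (cases "\<exists>S\<subseteq>{..<N}. run N (letters w) S \<noteq> None")
      case False
      then have "wd (letters w) \<in> I"
        using wN[OF w] by (intro run_None_in_ideal) auto
      then have "Poly_Mapping.single 0 (Poly_Mapping.lookup p w) * wd (letters w) \<in> I"
        by (intro ideal_lmult single_mem_words_alg) (simp_all add: zero_word_def)
      then show ?thesis using w that[of "{w}"] by (simp add: mult_single)
    next
      case True
      then obtain S T where S: "S \<subseteq> {..<N}" "run N (letters w) S = Some T" by auto
      define K where "K = {v \<in> Poly_Mapping.keys p. run N (letters v) S = Some T
          \<and> count_list (letters v) 0 = count_list (letters w) 0}"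
      have fin: "finite K" by (simp add: K_def)
      have "0 = Polynomial.coeff (mat N p T S) (count_list (letters w) 0)"
        using less.prems(2)[OF run_subset[OF S(2,1)] S(1)] N by simp
      also have "\<dots> = (\<Sum>v\<in>Poly_Mapping.keys p. if v \<in> K then Poly_Mapping.lookup p v else 0)"
        unfolding mat_def lin_ext_def coeff_sum
        by (intro sum.cong) (auto simp: entry_def K_def)
      also have "\<dots> = (\<Sum>v\<in>K. Poly_Mapping.lookup p v)"
        by (simp add: sum.If_cases) (intro sum.cong, auto simp: K_def)
      finally have sum0: "(\<Sum>v\<in>K. Poly_Mapping.lookup p v) = 0" by simp
      have "(\<Sum>v\<in>K. Poly_Mapping.single v (Poly_Mapping.lookup p v))
          = (\<Sum>v\<in>K. Poly_Mapping.single 0 (Poly_Mapping.lookup p v) * (wd (letters v) - wd (letters w)))"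
      proof -
        have "(\<Sum>v\<in>K. Poly_Mapping.single w (Poly_Mapping.lookup p v)) = 0"
          using single_sum[of w "Poly_Mapping.lookup p" K] sum0 by simp
        then have "(\<Sum>v\<in>K. Poly_Mapping.single v (Poly_Mapping.lookup p v))
            = (\<Sum>v\<in>K. Poly_Mapping.single v (Poly_Mapping.lookup p v)
                - Poly_Mapping.single w (Poly_Mapping.lookup p v))"
          by (simp only: sum_subtractf diff_0_right)
        then show ?thesis by (simp add: right_diff_distrib mult_single)
      qed
      also have "\<dots> \<in> I"
      proof (intro ideal_sum ideal_lmult)
        fix v assume v: "v \<in> K"
        then have vp: "v \<in> Poly_Mapping.keys p" and rv: "run N (letters v) S = Some T"
          and c0: "count_list (letters v) 0 = count_list (letters w) 0" by (auto simp: K_def)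
        have "count_list (letters v) i = count_list (letters w) i" for i
        proof (cases "i < N")
          case True
          show ?thesis
            by (rule run_counts_unique[OF rv S(2) wN[OF vp] wN[OF w] _ c0 True]) (use N in simp)
        next
          case False
          then have "i \<notin> set (letters v)" "i \<notin> set (letters w)" using wN[OF vp] wN[OF w] by auto
          then show ?thesis by simp
        qed
        then show "wd (letters v) - wd (letters w) \<in> I"
          using rv S wN[OF vp] wN[OF w] by (intro same_counts_eqv)
        show "Poly_Mapping.single 0 (Poly_Mapping.lookup p v) \<in> words_alg N"
          by (intro single_mem_words_alg) (simp add: zero_word_def)
      qed
      finally show ?thesis using w S that[of K] by (auto simp: K_def)
    qed
    let ?q = "\<Sum>v\<in>K. Poly_Mapping.single v (Poly_Mapping.lookup p v)"
    have finK: "finite K" by (rule finite_subset[OF K(1)]) simp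
    have lk: "Poly_Mapping.lookup (p - ?q) v = (if v \<in> K then 0 else Poly_Mapping.lookup p v)" for v
      using finK by (simp only: lookup_minus lookup_sum lookup_single when_def sum.delta) simp
    have keys: "Poly_Mapping.keys (p - ?q) = Poly_Mapping.keys p - K"
      by (rule Set.set_eqI) (simp add: in_keys_iff lk del: lookup_minus)
    have "p - ?q \<in> I"
    proof (rule less.hyps)
      show "card (Poly_Mapping.keys (p - ?q)) < card (Poly_Mapping.keys p)"
        unfolding keys using K w by (intro psubset_card_mono) auto
      show "p - ?q \<in> words_alg N"
        by (rule diff_mem[OF less.prems(1) subsetD[OF ideal_subset K(3)]])
      show "mat N (p - ?q) T S = 0" if "T \<subseteq> {..<N}" "S \<subseteq> {..<N}" for T S
        unfolding mat_simps less.prems(2)[OF that] mat_ideal[OF K(3) that(2)] by (rule diff_self)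
    qed
    then show ?thesis using K(3) ideal_eqv by blast
  qed
qed

end


section \<open>Central elements act by scalars on each particle number\<close>

lemma (in ring) subring_ring_center: "subring (ring_center R) R"
proof (rule subringI)
  have carr: "x \<in> carrier R" and comm: "z \<in> carrier R \<Longrightarrow> x \<otimes> z = z \<otimes> x"
    if "x \<in> ring_center R" for x z
    using that unfolding ring_center_def by blast+
  have mem: "x \<in> ring_center R" if "x \<in> carrier R" "\<And>z. z \<in> carrier R \<Longrightarrow> x \<otimes> z = z \<otimes> x" for x
    using that unfolding ring_center_def by blast
  show "ring_center R \<subseteq> carrier R" using carr by blast
  show "\<one> \<in> ring_center R" by (rule mem) simp_all
  fix x y assume x: "x \<in> ring_center R" and y: "y \<in> ring_center R"
  note xy = carr[OF x] carr[OF y]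
  show "x \<oplus> y \<in> ring_center R"
  proof (rule mem)
    fix z assume "z \<in> carrier R"
    then show "(x \<oplus> y) \<otimes> z = z \<otimes> (x \<oplus> y)"
      using comm[OF x, of z] comm[OF y, of z] by (simp only: l_distr r_distr xy)
  qed (use xy in simp)
  show "\<ominus> x \<in> ring_center R"
  proof (rule mem)
    fix z assume "z \<in> carrier R"
    then show "(\<ominus> x) \<otimes> z = z \<otimes> (\<ominus> x)"
      using comm[OF x, of z] by (simp only: l_minus r_minus xy)
  qed (use xy in simp)
  show "x \<otimes> y \<in> ring_center R"
  proof (rule mem)
    fix z assume z: "z \<in> carrier R"
    have "x \<otimes> y \<otimes> z = x \<otimes> (z \<otimes> y)" by (simp only: m_assoc xy z comm[OF y])
    also have "\<dots> = z \<otimes> x \<otimes> y" by (simp only: m_assoc[symmetric] xy z comm[OF x])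
    also have "\<dots> = z \<otimes> (x \<otimes> y)" by (rule m_assoc[OF z xy])
    finally show "x \<otimes> y \<otimes> z = z \<otimes> (x \<otimes> y)" .
  qed (use xy in simp)
qed

context affine_nTL
begin

abbreviation A :: "(word \<Rightarrow>\<^sub>0 'k) set ring" where "A \<equiv> nTL N"
abbreviation scal :: "'k \<Rightarrow> (word \<Rightarrow>\<^sub>0 'k) set" where "scal \<equiv> nTL_scalar N"
abbreviation Z :: "(word \<Rightarrow>\<^sub>0 'k) set set" where "Z \<equiv> ring_center A"

lemma nTL_conv: "A = ring_on (words_alg N) Quot I"
  by (simp add: nTL_def free_alg_conv I_def)

lemma carrier_A: "carrier A = coset ` words_alg N"
  unfolding nTL_conv by (rule carrier_quotient)

lemmas A_simps = quotient_simps[folded nTL_conv]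

sublocale A: ring A
  unfolding nTL_conv by (rule quotient_is_ring)

lemma N_pos: "N > 0" and N2: "N \<ge> 2"
  using N by auto

text \<open>
  Any representative of the coset will do, because \<^const>\<open>mat\<close> vanishes on the ideal.
\<close>

definition rep :: "(word \<Rightarrow>\<^sub>0 'k) set \<Rightarrow> nat set \<Rightarrow> nat set \<Rightarrow> 'k poly" where
  "rep a = mat N (SOME p. p \<in> a)"

lemma rep_coset:
  assumes "p \<in> words_alg N" "S \<subseteq> {..<N}"
  shows "rep (coset p) T S = mat N p T S"
proof -
  have "(SOME q. q \<in> coset p) \<in> coset p" by (rule someI) (rule coset_self)
  then have "mat N ((SOME q. q \<in> coset p) - p) T S = 0"
    by (intro mat_ideal assms) (simp add: mem_coset_iff)
  then show ?thesis by (simp add: rep_def)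
qed

lemma rep_mult:
  assumes "a \<in> carrier A" "b \<in> carrier A" "S \<subseteq> {..<N}"
  shows "rep (a \<otimes>\<^bsub>A\<^esub> b) T S = (\<Sum>U\<in>Pow {..<N}. rep a T U * rep b U S)"
proof -
  obtain p q where "p \<in> words_alg N" "a = coset p" "q \<in> words_alg N" "b = coset q"
    using assms unfolding carrier_A by auto
  then show ?thesis using assms(3)
    by (auto simp: A_simps rep_coset mult_mem mat_mult N_pos intro!: sum.cong)
qed

lemma rep_add:
  assumes "a \<in> carrier A" "b \<in> carrier A" "S \<subseteq> {..<N}"
  shows "rep (a \<oplus>\<^bsub>A\<^esub> b) T S = rep a T S + rep b T S"
proof -
  obtain p q where "p \<in> words_alg N" "a = coset p" "q \<in> words_alg N" "b = coset q"
    using assms unfolding carrier_A by auto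
  then show ?thesis using assms(3) by (auto simp: A_simps rep_coset add_mem)
qed

lemma rep_zero: "S \<subseteq> {..<N} \<Longrightarrow> rep \<zero>\<^bsub>A\<^esub> T S = 0"
  by (simp add: A_simps rep_coset zero_mem)

lemma scalar_conv: "scal c = coset (Poly_Mapping.single 0 c)"
  by (simp add: nTL_scalar_def I_def free_alg_conv)

lemma single_0_mem: "Poly_Mapping.single 0 c \<in> words_alg N"
  by (rule single_mem_words_alg) (simp add: zero_word_def)

lemma scalar_mem: "scal c \<in> carrier A"
  using single_0_mem by (auto simp: scalar_conv carrier_A)

lemma rep_scalar: "S \<subseteq> {..<N} \<Longrightarrow> rep (scal c) T S = (if S = T then [:c:] else 0)"
  by (simp add: scalar_conv rep_coset single_0_mem mat_scalar del: mat_simps)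

lemma scalar_one: "scal 1 = \<one>\<^bsub>A\<^esub>"
  by (simp add: scalar_conv A_simps)

lemma rep_one: "S \<subseteq> {..<N} \<Longrightarrow> rep \<one>\<^bsub>A\<^esub> T S = (if S = T then 1 else 0)"
  using rep_scalar[of S 1 T] by (simp add: scalar_one one_pCons)

lemma rep_uminus:
  assumes "a \<in> carrier A" "S \<subseteq> {..<N}"
  shows "rep (\<ominus>\<^bsub>A\<^esub> a) T S = - rep a T S"
proof -
  have "rep (\<ominus>\<^bsub>A\<^esub> a) T S + rep a T S = rep (\<ominus>\<^bsub>A\<^esub> a \<oplus>\<^bsub>A\<^esub> a) T S"
    by (rule rep_add[symmetric]) (use assms in auto)
  also have "\<dots> = 0" unfolding A.l_neg[OF assms(1)] by (rule rep_zero[OF assms(2)])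
  finally show ?thesis by (rule eq_neg_iff_add_eq_0[THEN iffD2])
qed

lemma rep_finsum:
  assumes "\<And>x. x \<in> F \<Longrightarrow> f x \<in> carrier A" "S \<subseteq> {..<N}" "finite F"
  shows "rep (finsum A f F) T S = (\<Sum>x\<in>F. rep (f x) T S)"
  using assms(3,1)
proof (induction F rule: finite_induct)
  case empty then show ?case using assms(2) by (simp add: rep_zero)
next
  case (insert x F)
  then have "finsum A f (insert x F) = f x \<oplus>\<^bsub>A\<^esub> finsum A f F"
    by (intro A.finsum_insert) auto
  moreover have "finsum A f F \<in> carrier A" using insert by (intro A.finsum_closed) auto
  ultimately show ?case using insert assms(2) by (simp add: rep_add)
qed

lemma rep_eqI:
  assumes "a \<in> carrier A" "b \<in> carrier A"
    and "\<And>T S. T \<subseteq> {..<N} \<Longrightarrow> S \<subseteq> {..<N} \<Longrightarrow> rep a T S = rep b T S"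
  shows "a = b"
proof -
  obtain p q where pq: "p \<in> words_alg N" "a = coset p" "q \<in> words_alg N" "b = coset q"
    using assms unfolding carrier_A by auto
  have "mat N (p - q) T S = 0" if "T \<subseteq> {..<N}" "S \<subseteq> {..<N}" for T S
    using assms(3)[OF that] that pq by (simp add: rep_coset)
  then have "p - q \<in> I" using pq by (intro mat_faithful diff_mem)
  then show ?thesis using pq by (simp add: coset_eq_iff)
qed

lemma rep_card:
  assumes "a \<in> carrier A" "S \<subseteq> {..<N}" "rep a T S \<noteq> 0"
  shows "card T = card S"
proof -
  obtain p where p: "p \<in> words_alg N" "a = coset p"
    using assms unfolding carrier_A by auto
  then have "lin_ext (entry N T S) p \<noteq> 0" using assms by (simp add: rep_coset mat_def)
  then obtain w where "entry N T S w \<noteq> (0 :: 'k poly)"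
    unfolding lin_ext_def by (metis (no_types, lifting) smult_0_right sum.neutral)
  then have "run N (letters w) S = Some T" by (auto simp: entry_def split: if_splits)
  then show ?thesis using run_card finite_subset[OF assms(2)] by auto
qed

text \<open>
  The diagonal entries have a common constant coefficient: a word that returns to its source without
  leaving the place 0 uses no letter at all.
\<close>

lemma entry_diag_coeff_0:
  assumes "set (letters w) \<subseteq> {..<N}"
  shows "Polynomial.coeff (entry N S S w) 0 = (if w = 0 then 1 else (0::'k))"
proof (cases "run N (letters w) S = Some S \<and> count_list (letters w) 0 = 0")
  case True
  have "i \<notin> set (letters w)" for i
    using run_balanced[OF _ assms N2, of S i] True assms
    by (cases "i < N") (auto simp: count_list_0_iff)
  then have "letters w = []" by (metis list.set_intros(1) neq_Nil_conv)
  then have "w = 0" by (cases w) (simp add: zero_word_def)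
  then show ?thesis using True by (simp add: entry_def)
next
  case False
  then have "w \<noteq> 0" by (auto simp: zero_word_def)
  then show ?thesis using False by (auto simp: entry_def)
qed

lemma rep_coset_coeff_0:
  assumes "p \<in> words_alg N" "S \<subseteq> {..<N}"
  shows "Polynomial.coeff (rep (coset p) S S) 0 = Poly_Mapping.lookup p 0"
proof -
  have "Polynomial.coeff (rep (coset p) S S) 0
      = (\<Sum>w\<in>Poly_Mapping.keys p. if w = 0 then Poly_Mapping.lookup p w else 0)"
    unfolding rep_coset[OF assms] mat_def lin_ext_def coeff_sum
    using assms(1) by (intro sum.cong) (auto simp: words_alg_def entry_diag_coeff_0)
  then show ?thesis by (simp add: sum.delta in_keys_iff)
qed

lemma rep_coeff_0:
  assumes "a \<in> carrier A" "S \<subseteq> {..<N}" "S' \<subseteq> {..<N}"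
  shows "Polynomial.coeff (rep a S S) 0 = Polynomial.coeff (rep a S' S') 0"
  using assms unfolding carrier_A by (auto simp: rep_coset_coeff_0)

text \<open>
  No letter acts on the empty or on the full circle, so only the empty word contributes.
\<close>

lemma rep_trivial:
  assumes "a \<in> carrier A" "S = {} \<or> S = {..<N}"
  shows "rep a S S = [:Polynomial.coeff (rep a S S) 0:]"
proof -
  obtain p where p: "p \<in> words_alg N" "a = coset p"
    using assms unfolding carrier_A by auto
  have S: "S \<subseteq> {..<N}" using assms(2) by auto
  have stuck: "run N w S = Some T \<Longrightarrow> set w \<subseteq> {..<N} \<Longrightarrow> w = [] \<and> T = S" for w T
  proof (induction w arbitrary: T)
    case (Cons j w)
    then obtain U where "run N w S = Some U" "hop N j U = Some T"
      by (auto simp: bind_eq_Some_conv)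
    then have "hop N j S = Some T" using Cons by auto
    then show ?case using assms(2) N_pos by (auto simp: hop_Some_iff)
  qed auto
  have "entry N S S w = (if w = 0 then 1 else (0 :: 'k poly))" if "w \<in> Poly_Mapping.keys p" for w
  proof (cases w)
    case (Word xs)
    then have "set xs \<subseteq> {..<N}" using p(1) that unfolding words_alg_def by force
    then show ?thesis using Word stuck[of xs S] by (auto simp: entry_def zero_word_def)
  qed
  then have "rep a S S = (\<Sum>w\<in>Poly_Mapping.keys p. if w = 0 then [:Poly_Mapping.lookup p w:] else 0)"
    unfolding p(2) rep_coset[OF p(1) S] mat_def lin_ext_def by (intro sum.cong) (auto simp: one_pCons)
  also have "\<dots> = [:Poly_Mapping.lookup p 0:]" by (simp add: sum.delta in_keys_iff)
  finally show ?thesis by simp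
qed

lemma gen_conv: "nTL_gen N j = coset (wd [j mod N])"
  by (simp add: nTL_gen_def I_def free_alg_conv free_gen_def)

lemma wd_mod_mem: "wd (map (\<lambda>j. j mod N) js) \<in> words_alg N"
  using N_pos by (intro wd_mem) auto

lemma gen_mem: "nTL_gen N j \<in> carrier A"
  using wd_mod_mem[of "[j]"] by (auto simp: gen_conv carrier_A)

lemma rep_gen:
  assumes "j < N" "S \<subseteq> {..<N}"
  shows "rep (nTL_gen N j) T S
    = (if hop N j S = Some T then Polynomial.monom 1 (if j = 0 then 1 else 0) else 0)"
proof -
  have "wd [j] \<in> words_alg N" using assms by (intro wd_mem) auto
  then show ?thesis using assms by (simp add: gen_conv rep_coset entry_def)
qed

text \<open>
  The two sides are the matrix entries of \<open>a\<close> times a generator and of the generator times \<open>a\<close>, after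
  cancellation of the common weight \<open>1\<close> or \<open>q\<close> of the generator. The next lemmas evaluate these sums,
  which have at most one nonzero term.
\<close>

lemma center_commutes_with_hop:
  assumes "a \<in> Z" "j < N" "T \<subseteq> {..<N}" "S \<subseteq> {..<N}"
  shows "(\<Sum>U\<in>Pow {..<N}. rep a T U * (if hop N j S = Some U then 1 else 0))
    = (\<Sum>U\<in>Pow {..<N}. if hop N j U = Some T then rep a U S else 0)"
proof -
  let ?q = "Polynomial.monom 1 (if j = 0 then 1 else 0) :: 'k poly"
  have a: "a \<in> carrier A" using assms(1) by (simp add: ring_center_def)
  have "a \<otimes>\<^bsub>A\<^esub> nTL_gen N j = nTL_gen N j \<otimes>\<^bsub>A\<^esub> a"
    using assms(1) gen_mem by (auto simp: ring_center_def)
  then have "(\<Sum>U\<in>Pow {..<N}. rep a T U * rep (nTL_gen N j) U S)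
      = (\<Sum>U\<in>Pow {..<N}. rep (nTL_gen N j) T U * rep a U S)"
    using rep_mult[OF a gen_mem[of j] assms(4), of T] rep_mult[OF gen_mem[of j] a assms(4), of T] by metis
  also have "(\<Sum>U\<in>Pow {..<N}. rep a T U * rep (nTL_gen N j) U S)
      = ?q * (\<Sum>U\<in>Pow {..<N}. rep a T U * (if hop N j S = Some U then 1 else 0))"
    unfolding sum_distrib_left using assms by (intro sum.cong) (auto simp: rep_gen)
  also have "(\<Sum>U\<in>Pow {..<N}. rep (nTL_gen N j) T U * rep a U S)
      = ?q * (\<Sum>U\<in>Pow {..<N}. if hop N j U = Some T then rep a U S else 0)"
    unfolding sum_distrib_left using assms by (intro sum.cong) (auto simp: rep_gen)
  finally show ?thesis by (simp add: monom_eq_0_iff)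
qed

lemma center_source_sum:
  assumes "hop N j U0 = Some T" "U0 \<subseteq> {..<N}"
  shows "(\<Sum>U\<in>Pow {..<N}. if hop N j U = Some T then rep a U S else 0) = rep a U0 S"
proof -
  have "hop N j U = Some T \<longleftrightarrow> U = U0" for U using hop_inj assms(1) by metis
  then show ?thesis using assms(2) by (simp add: sum.delta)
qed

lemma center_target_sum:
  assumes "hop N j S = Some S'" "S \<subseteq> {..<N}"
  shows "(\<Sum>U\<in>Pow {..<N}. rep a T U * (if hop N j S = Some U then 1 else 0)) = rep a T S'"
  using assms hop_subset[OF assms N_pos]
  by (simp add: if_distrib[of "\<lambda>x. _ * x"] sum.delta cong: if_cong)

lemma center_hop_both:
  assumes "a \<in> Z" "j < N" "T \<subseteq> {..<N}" "S \<subseteq> {..<N}" "hop N j T = Some T'" "hop N j S = Some S'"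
  shows "rep a T' S' = rep a T S"
  using center_commutes_with_hop[OF assms(1,2) hop_subset[OF assms(5,3) N_pos] assms(4)]
    center_source_sum[OF assms(5,3)] center_target_sum[OF assms(6,4)] by simp

lemma center_hop_source:
  assumes "a \<in> Z" "j < N" "T \<subseteq> {..<N}" "S \<subseteq> {..<N}" "hop N j T = Some T'" "hop N j S = None"
  shows "rep a T S = 0"
  using center_commutes_with_hop[OF assms(1,2) hop_subset[OF assms(5,3) N_pos] assms(4)]
    center_source_sum[OF assms(5,3)] assms(6) by simp

lemma center_hop_target:
  assumes "a \<in> Z" "j < N" "T' \<subseteq> {..<N}" "S \<subseteq> {..<N}" "hop N j S = Some S'"
    "\<And>U. U \<subseteq> {..<N} \<Longrightarrow> hop N j U \<noteq> Some T'"
  shows "rep a T' S' = 0"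
proof -
  have "(\<Sum>U\<in>Pow {..<N}. if hop N j U = Some T' then rep a U S else 0) = 0"
    using assms(6) by (intro sum.neutral) auto
  then show ?thesis
    using center_commutes_with_hop[OF assms(1-4)] center_target_sum[OF assms(5,4)] by simp
qed

lemma hop_predecessor:
  assumes "j < N" "j \<notin> S" "nx N j \<in> S" "S \<subseteq> {..<N}"
  shows "hop N j (insert j (S - {nx N j})) = Some S" "insert j (S - {nx N j}) \<subseteq> {..<N}"
  using assms nx_neq[OF assms(1) N2] by (auto simp: hop_Some_iff)

text \<open>
  On a circle, the occupied blocks have as many ends as beginnings.
\<close>

lemma card_descents_eq_card_ascents:
  "card {j. j < N \<and> j \<in> S \<and> nx N j \<notin> S} = card {j. j < N \<and> j \<notin> S \<and> nx N j \<in> S}"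
proof -
  have "bij_betw (nx N) {j. j < N \<and> nx N j \<in> S} {j. j < N \<and> j \<in> S}"
  proof (rule bij_betw_imageI)
    show "inj_on (nx N) {j. j < N \<and> nx N j \<in> S}" using nx_inj by (intro inj_onI) auto
    show "nx N ` {j. j < N \<and> nx N j \<in> S} = {j. j < N \<and> j \<in> S}"
    proof
      show "{j. j < N \<and> j \<in> S} \<subseteq> nx N ` {j. j < N \<and> nx N j \<in> S}"
      proof
        fix i assume i: "i \<in> {j. j < N \<and> j \<in> S}"
        then have "i < N" by simp
        then obtain j where "j < N" "i = nx N j" using nx_surj by metis
        with i show "i \<in> nx N ` {j. j < N \<and> nx N j \<in> S}" by blast
      qed
    qed (use N_pos in auto)
  qed
  then have *: "card {j. j < N \<and> nx N j \<in> S} = card {j. j < N \<and> j \<in> S}"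
    by (rule bij_betw_same_card)
  let ?B = "{j. j < N \<and> j \<in> S \<and> nx N j \<in> S}"
  let ?D = "{j. j < N \<and> j \<in> S \<and> nx N j \<notin> S}"
  let ?U = "{j. j < N \<and> j \<notin> S \<and> nx N j \<in> S}"
  have "{j. j < N \<and> j \<in> S} = ?B \<union> ?D" "{j. j < N \<and> nx N j \<in> S} = ?B \<union> ?U" by auto
  moreover have "card (?B \<union> ?D) = card ?B + card ?D" "card (?B \<union> ?U) = card ?B + card ?U"
    by (rule card_Un_disjoint; auto)+
  ultimately have "card ?B + card ?D = card ?B + card ?U" using * by simp
  then show ?thesis by (rule add_left_imp_eq)
qed

text \<open>
  If the entry from \<open>S\<close> to \<open>T\<close> is nonzero, then every end of a block of \<open>T\<close> is one of \<open>S\<close> and every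
  beginning of a block of \<open>S\<close> is one of \<open>T\<close>. As there are as many ends as beginnings, \<open>S\<close> and \<open>T\<close>
  have the same ends and beginnings. If they still differ, then one of them is full and the other
  empty, which is impossible for equal cardinalities.
\<close>

lemma center_diagonal:
  assumes "a \<in> Z" "T \<subseteq> {..<N}" "S \<subseteq> {..<N}" "T \<noteq> S"
  shows "rep a T S = 0"
proof (rule ccontr)
  assume nz: "rep a T S \<noteq> 0"
  have a: "a \<in> carrier A" using assms(1) by (simp add: ring_center_def)
  have fin: "finite S" "finite T" using assms finite_subset by auto
  have card: "card T = card S" by (rule rep_card[OF a assms(3) nz])
  let ?D = "\<lambda>S. {j. j < N \<and> j \<in> S \<and> nx N j \<notin> S}"
  let ?U = "\<lambda>S. {j. j < N \<and> j \<notin> S \<and> nx N j \<in> S}"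
  have D: "?D T \<subseteq> ?D S"
  proof
    fix j assume j: "j \<in> ?D T"
    then have "hop N j T = Some (insert (nx N j) (T - {j}))" by (simp add: hop_Some_iff)
    then have "hop N j S \<noteq> None" using center_hop_source[OF assms(1) _ assms(2,3)] nz j by auto
    then show "j \<in> ?D S" using j by (auto simp: hop_None_iff)
  qed
  have U: "?U S \<subseteq> ?U T"
  proof
    fix j assume j: "j \<in> ?U S"
    then have j': "j < N" "j \<notin> S" "nx N j \<in> S" by simp_all
    have "\<exists>U\<subseteq>{..<N}. hop N j U = Some T"
    proof (rule ccontr)
      assume "\<not> ?thesis"
      then have "rep a T S = 0"
        by (intro center_hop_target[OF assms(1) j'(1) assms(2)
              hop_predecessor(2)[OF j' assms(3)] hop_predecessor(1)[OF j' assms(3)]]) blast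
      with nz show False by simp
    qed
    then show "j \<in> ?U T" using j nx_neq[of j N] N2 by (auto simp: hop_Some_iff)
  qed
  have finDU: "finite (?D S)" "finite (?U T)" by auto
  have le: "card (?D T) \<le> card (?D S)" "card (?U S) \<le> card (?U T)"
    using card_mono[OF finDU(1) D] card_mono[OF finDU(2) U] by blast+
  note le' = le[unfolded card_descents_eq_card_ascents]
  have Deq: "?D T = ?D S"
    by (rule card_seteq[OF finDU(1) D]) (unfold card_descents_eq_card_ascents, rule le')
  have Ueq: "?U S = ?U T"
    by (rule card_seteq[OF finDU(2) U]) (rule le')
  have Deq': "j \<in> T \<and> nx N j \<notin> T \<longleftrightarrow> j \<in> S \<and> nx N j \<notin> S" if "j < N" for j
  proof -
    have "j \<in> ?D T \<longleftrightarrow> j \<in> ?D S" by (simp only: Deq)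
    then show ?thesis using that by simp
  qed
  have Ueq': "j \<notin> T \<and> nx N j \<in> T \<longleftrightarrow> j \<notin> S \<and> nx N j \<in> S" if "j < N" for j
  proof -
    have "j \<in> ?U T \<longleftrightarrow> j \<in> ?U S" by (simp only: Ueq)
    then show ?thesis using that by simp
  qed
  have full: "P = {..<N} \<and> Q = {}"
    if PQ: "P \<subseteq> {..<N}" "Q \<subseteq> {..<N}" "i \<in> P" "i \<notin> Q"
      and eqs: "\<And>j. j < N \<Longrightarrow> (j \<in> P \<and> nx N j \<notin> P) = (j \<in> Q \<and> nx N j \<notin> Q)"
        "\<And>j. j < N \<Longrightarrow> (j \<notin> P \<and> nx N j \<in> P) = (j \<notin> Q \<and> nx N j \<in> Q)"
    for P Q :: "nat set" and i
  proof -
    have "m \<in> P \<and> m \<notin> Q" if "m < N" for m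
    proof (rule cyclic_induct[where P = "\<lambda>j. j \<in> P \<and> j \<notin> Q" and i = i])
      show "nx N j \<in> P \<and> nx N j \<notin> Q" if "j < N" "j \<in> P \<and> j \<notin> Q" for j
        using eqs[OF that(1)] that(2) by blast
    qed (use PQ that in auto)
    then show ?thesis using PQ by auto
  qed
  consider i where "i \<in> S" "i \<notin> T" | i where "i \<in> T" "i \<notin> S" using assms(4) by blast
  then show False
  proof cases
    case 1
    then have "S = {..<N} \<and> T = {}" by (rule full[OF assms(3,2)]) (metis Deq' Ueq')+
    then show False using card N_pos by simp
  next
    case 2
    then have "T = {..<N} \<and> S = {}" by (rule full[OF assms(2,3)]) (metis Deq' Ueq')+
    then show False using card N_pos by simp
  qed
qed

lemma not_initial_segment:
  assumes "finite (S :: nat set)" "S \<noteq> {..<card S}"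
  obtains j where "j \<notin> S" "Suc j \<in> S"
proof -
  have "S = {..<card S}" if *: "\<And>j. Suc j \<in> S \<Longrightarrow> j \<in> S"
  proof -
    have down: "x - d \<in> S" if "x \<in> S" for x d
    proof (induction d)
      case (Suc d)
      then show ?case using *[of "x - Suc d"] by (cases "x - d") (auto simp: Suc_diff_Suc)
    qed (use that in simp)
    show ?thesis
    proof (cases "S = {}")
      case False
      have "S = {..Max S}"
      proof
        show "{..Max S} \<subseteq> S"
        proof
          fix y assume "y \<in> {..Max S}"
          then show "y \<in> S"
            using down[OF Max_in[OF assms(1) False], of "Max S - y"] by simp
        qed
      qed (use assms(1) in auto)
      then have "S = {..<Suc (Max S)}" by (simp add: lessThan_Suc_atMost)
      then show ?thesis by (metis card_lessThan)
    qed simp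
  qed
  then show ?thesis using that assms(2) by blast
qed

text \<open>
  The scalar by which a central element acts on \<open>j\<close> particles, read off at one configuration.
\<close>

definition chi :: "nat \<Rightarrow> (word \<Rightarrow>\<^sub>0 'k) set \<Rightarrow> 'k poly" where
  "chi j a = rep a {..<j} {..<j}"

text \<open>
  Every configuration is reached by hops from the initial segment of the same size, and a hop does
  not change the diagonal entry of a central element. The sum of the places decreases when a hop is
  undone that does not cross from \<open>N - 1\<close> to \<open>0\<close>.
\<close>

lemma center_constant_diagonal:
  assumes "a \<in> Z" "S \<subseteq> {..<N}"
  shows "rep a S S = chi (card S) a"
  using assms(2)
proof (induction "\<Sum>S" arbitrary: S rule: less_induct)
  case less
  have fin: "finite S" using less.prems finite_subset by auto
  show ?case
  proof (cases "S = {..<card S}")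
    case True
    then show ?thesis by (metis chi_def)
  next
    case False
    then obtain j where j: "j \<notin> S" "Suc j \<in> S" using not_initial_segment[OF fin] by metis
    then have "Suc j < N" using less.prems by auto
    then have nx: "nx N j = Suc j" "j < N" by auto
    let ?S = "insert j (S - {Suc j})"
    have hop: "hop N j ?S = Some S" "?S \<subseteq> {..<N}"
      using hop_predecessor[OF nx(2) j(1) _ less.prems] j nx by simp_all
    have "\<Sum>S = Suc j + \<Sum>(S - {Suc j})" using sum.remove[OF fin j(2), of id] by simp
    then have "\<Sum>?S < \<Sum>S" using j fin by simp
    then have "rep a ?S ?S = chi (card ?S) a" using hop(2) less.hyps by blast
    moreover have "card ?S = card S" using hop_card[OF hop(1)] fin by simp
    ultimately show ?thesis using center_hop_both[OF assms(1) nx(2) hop(2,2,1,1)] by simp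
  qed
qed

lemma center_rep:
  assumes "a \<in> Z" "T \<subseteq> {..<N}" "S \<subseteq> {..<N}"
  shows "rep a T S = (if T = S then chi (card S) a else 0)"
  using assms center_diagonal center_constant_diagonal by auto

lemma chi_coeff_0:
  assumes "a \<in> carrier A" "i \<le> N" "j \<le> N"
  shows "Polynomial.coeff (chi i a) 0 = Polynomial.coeff (chi j a) 0"
  unfolding chi_def using assms by (intro rep_coeff_0) auto

text \<open>
  The scalars for \<open>0\<close> and \<open>N\<close> particles are constant, hence determined by the constant coefficient
  that they share with all other scalars.
\<close>

theorem center_eqI:
  assumes "a \<in> Z" "b \<in> Z" "\<And>j. j \<in> {1..N - 1} \<Longrightarrow> chi j a = chi j b"
  shows "a = b"
proof (rule rep_eqI)
  show XY: "a \<in> carrier A" "b \<in> carrier A" using assms by (auto simp: ring_center_def)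
  fix T S assume TS: "T \<subseteq> {..<N}" "S \<subseteq> {..<N}"
  have "chi (card S) a = chi (card S) b"
  proof (cases "card S \<in> {1..N - 1}")
    case True then show ?thesis by (rule assms)
  next
    case False
    have "finite S" "card S \<le> N" using TS finite_subset card_mono[of "{..<N}" S] by auto
    with False have S: "S = {} \<or> S = {..<N}"
      using card_subset_eq[OF _ TS(2)] by (cases "card S = 0") auto
    have 1: "1 \<in> {1..N - 1}" using N by auto
    have "rep a S S = rep b S S"
      using rep_trivial[OF XY(1) S] rep_trivial[OF XY(2) S]
        rep_coeff_0[OF XY(1) TS(2), of "{..<1}"] rep_coeff_0[OF XY(2) TS(2), of "{..<1}"]
        assms(3)[OF 1] N by (simp add: chi_def)
    then show ?thesis using assms TS by (simp add: center_rep)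
  qed
  then show "rep a T S = rep b T S" using assms TS by (simp add: center_rep)
qed

text \<open>
  Every element of the algebra preserves the number of particles, so scalars that depend on this
  number only commute with it.
\<close>

lemma centerI:
  assumes "a \<in> carrier A"
    and "\<And>T S. T \<subseteq> {..<N} \<Longrightarrow> S \<subseteq> {..<N} \<Longrightarrow> rep a T S = (if T = S then f (card S) else 0)"
  shows "a \<in> Z"
  unfolding ring_center_def
proof (intro CollectI conjI ballI assms(1))
  fix b assume b: "b \<in> carrier A"
  show "a \<otimes>\<^bsub>A\<^esub> b = b \<otimes>\<^bsub>A\<^esub> a"
  proof (rule rep_eqI)
    fix T S assume TS: "T \<subseteq> {..<N}" "S \<subseteq> {..<N}"
    have "rep (a \<otimes>\<^bsub>A\<^esub> b) T S = (\<Sum>U\<in>Pow {..<N}. if U = T then f (card U) * rep b U S else 0)"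
      unfolding rep_mult[OF assms(1) b TS(2)] using TS by (intro sum.cong) (auto simp: assms(2))
    also have "\<dots> = f (card T) * rep b T S" using TS by (simp add: sum.delta)
    also have "\<dots> = rep b T S * f (card S)"
      using rep_card[OF b TS(2), of T] by (cases "rep b T S = 0") (auto simp: mult.commute)
    also have "\<dots> = (\<Sum>U\<in>Pow {..<N}. if U = S then rep b T U * f (card S) else 0)"
      using TS by (simp add: sum.delta)
    also have "\<dots> = rep (b \<otimes>\<^bsub>A\<^esub> a) T S"
      unfolding rep_mult[OF b assms(1) TS(2)] using TS by (intro sum.cong) (auto simp: assms(2))
    finally show "rep (a \<otimes>\<^bsub>A\<^esub> b) T S = rep (b \<otimes>\<^bsub>A\<^esub> a) T S" .
  qed (use assms b in auto)
qed

lemma Z_carrier: "a \<in> Z \<Longrightarrow> a \<in> carrier A"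
  by (simp add: ring_center_def)

lemma scalar_center: "scal c \<in> Z"
  by (rule centerI[where f = "\<lambda>_. [:c:]"]) (auto simp: scalar_mem rep_scalar)

lemma chi_scalar: "j \<le> N \<Longrightarrow> chi j (scal c) = [:c:]"
  by (simp add: chi_def rep_scalar)

lemma chi_one: "j \<le> N \<Longrightarrow> chi j \<one>\<^bsub>A\<^esub> = 1"
  by (simp add: chi_def rep_one)

lemma chi_add: "a \<in> carrier A \<Longrightarrow> b \<in> carrier A \<Longrightarrow> j \<le> N \<Longrightarrow> chi j (a \<oplus>\<^bsub>A\<^esub> b) = chi j a + chi j b"
  by (simp add: chi_def rep_add)

lemma chi_uminus: "a \<in> carrier A \<Longrightarrow> j \<le> N \<Longrightarrow> chi j (\<ominus>\<^bsub>A\<^esub> a) = - chi j a"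
  by (simp add: chi_def rep_uminus)

lemma chi_finsum:
  "(\<And>x. x \<in> F \<Longrightarrow> f x \<in> carrier A) \<Longrightarrow> finite F \<Longrightarrow> j \<le> N
    \<Longrightarrow> chi j (finsum A f F) = (\<Sum>x\<in>F. chi j (f x))"
  unfolding chi_def by (rule rep_finsum) auto

lemma chi_mult:
  assumes "a \<in> Z" "b \<in> carrier A" "j \<le> N"
  shows "chi j (a \<otimes>\<^bsub>A\<^esub> b) = chi j a * chi j b"
proof -
  have j: "{..<j} \<subseteq> {..<N}" using assms(3) by auto
  have "chi j (a \<otimes>\<^bsub>A\<^esub> b) = (\<Sum>U\<in>Pow {..<N}. if U = {..<j} then chi j a * chi j b else 0)"
    unfolding chi_def[of j "_ \<otimes>\<^bsub>_\<^esub> _"] rep_mult[OF Z_carrier[OF assms(1)] assms(2) j]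
    using center_rep[OF assms(1) j] by (intro sum.cong) (auto simp: chi_def)
  then show ?thesis using j by (simp add: sum.delta)
qed

end


section \<open>The monomials attached to index sets\<close>

text \<open>
  In a word without repetitions, this says that \<open>y\<close> acts before \<open>x\<close>. It allows the order of two letters
  to be checked inside the block of the word in which they occur.
\<close>

definition occurs_after :: "'a list \<Rightarrow> 'a \<Rightarrow> 'a \<Rightarrow> bool" where
  "occurs_after xs x y \<longleftrightarrow> (\<exists>u v. xs = u @ x # v \<and> y \<in> set v)"

lemma occurs_after_split:
  assumes "distinct (u @ x # v)" "occurs_after (u @ x # v) x y"
  shows "y \<in> set v"
proof -
  obtain u' v' where *: "u @ x # v = u' @ x # v'" "y \<in> set v'"
    using assms(2) by (auto simp: occurs_after_def)
  have "x \<notin> set u" "x \<notin> set v" using assms(1) by auto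
  then have "v = v'" using *(1) by (auto simp: append_Cons_eq_iff)
  then show ?thesis using *(2) by simp
qed

lemma occurs_after_append:
  "x \<in> set p \<Longrightarrow> y \<in> set q \<Longrightarrow> occurs_after (p @ q) x y"
  unfolding occurs_after_def by (metis UnCI append.assoc append_Cons set_append split_list)

lemma occurs_after_appendI1: "occurs_after p x y \<Longrightarrow> occurs_after (p @ q) x y"
  unfolding occurs_after_def by fastforce

lemma occurs_after_appendI2: "occurs_after q x y \<Longrightarrow> occurs_after (p @ q) x y"
  unfolding occurs_after_def by (metis append.assoc)

lemma occurs_after_concat:
  "ys \<in> set xss \<Longrightarrow> occurs_after ys x y \<Longrightarrow> occurs_after (concat xss) x y"
  by (induction xss) (auto intro: occurs_after_appendI1 occurs_after_appendI2)

lemma occurs_after_upt: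
  assumes "a \<le> s" "s < t" "t < b"
  shows "occurs_after (map f [a..<b]) (f s) (f t)"
proof -
  have "[a..<b] = [a..<s] @ s # [Suc s..<b]"
    using assms upt_add_eq_append[of a s "b - s"] upt_conv_Cons[of s b] by simp
  then show ?thesis using assms unfolding occurs_after_def by fastforce
qed

lemma occurs_after_rev_upt:
  assumes "a \<le> t" "t < s" "s < b"
  shows "occurs_after (rev [a..<b]) s t"
proof -
  have "[a..<b] = [a..<s] @ s # [Suc s..<b]"
    using assms upt_add_eq_append[of a s "b - s"] upt_conv_Cons[of s b] by simp
  then have "rev [a..<b] = rev [Suc s..<b] @ s # rev [a..<s]" by simp
  moreover have "t \<in> set (rev [a..<s])" using assms by simp
  ultimately show ?thesis unfolding occurs_after_def by blast
qed

text \<open>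
  The word of \<open>a_hat\<close>, with \<open>i\<close> in place of \<open>idx N J\<close> and without reduction modulo \<open>N\<close>.
\<close>

definition loop_word :: "(nat \<Rightarrow> nat) \<Rightarrow> nat \<Rightarrow> nat \<Rightarrow> nat list" where
  "loop_word i k l = rev [i k + 1..<i (k + 1)]
     @ concat (map (\<lambda>s. rev [i s + 1..<i (s + 1)]) [1..<k])
     @ map i [l + 1..<k + 1] @ map i [1..<l + 1]"

text \<open>
  The unreduced letters of \<^const>\<open>loop_word\<close> form the interval from \<open>i 1\<close> to \<open>i 1 + N - 1\<close>, each of
  them occurring once. The indices \<open>i s\<close> make up the tail of the word, the other letters form
  descending chunks between consecutive indices.
\<close>

locale cyclic_indices =
  fixes N k l :: nat and i :: "nat \<Rightarrow> nat"
  assumes step: "\<And>s. 1 \<le> s \<Longrightarrow> s \<le> k \<Longrightarrow> i s < i (s + 1)"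
    and period: "i (k + 1) = i 1 + N"
    and l: "1 \<le> l" "l \<le> k" and gap: "i l + 1 < i (l + 1)"
    and N2: "N \<ge> 2"
begin

abbreviation "w \<equiv> loop_word i k l"

lemma mono: "1 \<le> s \<Longrightarrow> s < t \<Longrightarrow> t \<le> k + 1 \<Longrightarrow> i s < i t"
proof (induction t)
  case (Suc t)
  then show ?case using step[of t] by (cases "s = t") auto
qed simp

lemma inj: "1 \<le> s \<Longrightarrow> s \<le> k + 1 \<Longrightarrow> 1 \<le> t \<Longrightarrow> t \<le> k + 1 \<Longrightarrow> i s = i t \<longleftrightarrow> s = t"
  using mono[of s t] mono[of t s] by (cases s t rule: linorder_cases) auto

lemma mod_inj:
  assumes "x \<in> {i 1..<i 1 + N}" "y \<in> {i 1..<i 1 + N}" "x mod N = y mod N"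
  shows "x = y"
proof -
  have le: "x = y" if "x mod N = y mod N" "x \<le> y" "x \<in> {i 1..<i 1 + N}" "y \<in> {i 1..<i 1 + N}" for x y
  proof -
    have "N dvd y - x" using that mod_eq_dvd_iff_nat[of x y N] by simp
    moreover have "y - x < N" using that by auto
    ultimately have "y - x = 0" by (metis nat_dvd_not_less neq0_conv)
    then show ?thesis using that by simp
  qed
  show ?thesis using le[of x y] le[of y x] assms by (cases "x \<le> y") auto
qed

lemma find_chunk:
  assumes "i 1 \<le> x" "x < i (k + 1)"
  obtains s where "1 \<le> s" "s \<le> k" "i s \<le> x" "x < i (s + 1)"
proof -
  have "\<exists>s. 1 \<le> s \<and> s \<le> m \<and> i s \<le> x \<and> x < i (s + 1)" if "1 \<le> m" "m \<le> k" "x < i (m + 1)" for m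
    using that
  proof (induction m)
    case (Suc m)
    show ?case
    proof (cases "i (Suc m) \<le> x")
      case True then show ?thesis using Suc by auto
    next
      case False
      then have "m \<noteq> 0" using assms(1) by (cases m) auto
      then show ?thesis using Suc False by (metis Suc_eq_plus1 Suc_leD le_SucI less_one not_less)
    qed
  qed simp
  then show ?thesis using that assms(2) l by (metis le_trans order_refl)
qed

lemma length_w: "length w = N"
proof -
  have "sum_list (map (\<lambda>s. i (s + 1) - (i s + 1)) [1..<Suc m]) + m + i 1 = i (Suc m)" if "m \<le> k" for m
    using that
  proof (induction m)
    case (Suc m)
    have "i (Suc m) < i (Suc (Suc m))" using step[of "Suc m"] Suc.prems by simp
    then show ?case using Suc by simp
  qed simp
  from this[of "k - 1"] have "sum_list (map (\<lambda>s. i (s + 1) - (i s + 1)) [1..<k]) + (k - 1) + i 1 = i k"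
    using l by simp
  moreover have "i k < i (k + 1)" using step[of k] l by simp
  moreover have "length w = (i (k + 1) - (i k + 1))
      + (sum_list (map (\<lambda>s. i (s + 1) - (i s + 1)) [1..<k]) + k)"
    using l by (simp add: loop_word_def length_concat comp_def)
  ultimately show ?thesis using period l by linarith
qed

lemma set_w: "set w = {i 1..<i 1 + N}"
proof
  have "i 1 \<le> i s \<and> i (s + 1) \<le> i 1 + N" if "1 \<le> s" "s \<le> k" for s
    using that mono[of 1 s] mono[of "s + 1" "k + 1"] period by (cases "s = 1"; cases "s = k"; auto)
  moreover have "i s < i 1 + N" if "1 \<le> s" "s \<le> k" for s
    using mono[of s "k + 1"] that period by auto
  ultimately show "set w \<subseteq> {i 1..<i 1 + N}"
    using l by (auto simp: loop_word_def) (metis Suc_eq_plus1 Suc_le_eq add_leD1 le_trans less_imp_le less_le_trans order_refl)+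
  show "{i 1..<i 1 + N} \<subseteq> set w"
  proof
    fix x assume x: "x \<in> {i 1..<i 1 + N}"
    then obtain s where s: "1 \<le> s" "s \<le> k" "i s \<le> x" "x < i (s + 1)"
      using find_chunk[of x] period by auto
    show "x \<in> set w"
    proof (cases "x = i s")
      case True
      have "s \<in> set [l + 1..<k + 1] \<or> s \<in> set [1..<l + 1]" using s by auto
      then show ?thesis using True by (auto simp: loop_word_def)
    next
      case False
      then have "x \<in> set (rev [i s + 1..<i (s + 1)])" using s by simp
      moreover have "s = k \<or> s \<in> set [1..<k]" using s by auto
      ultimately show ?thesis unfolding loop_word_def set_append set_concat set_map by blast
    qed
  qed
qed

lemma distinct_w: "distinct w"
  by (rule card_distinct) (simp add: set_w length_w)

definition "letters_mod = map (\<lambda>j. j mod N) w"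
definition "source = (\<lambda>j. j mod N) ` i ` {1..k}"

lemma distinct_mod: "distinct letters_mod"
  unfolding letters_mod_def distinct_map using distinct_w mod_inj by (auto simp: set_w intro!: inj_onI)

lemma set_mod: "set letters_mod = {..<N}"
proof (rule card_subset_eq)
  show "set letters_mod \<subseteq> {..<N}" using N2 by (auto simp: letters_mod_def)
  show "card (set letters_mod) = card {..<N}"
    using distinct_card[OF distinct_mod] by (simp add: letters_mod_def length_w)
qed simp

lemma indices_in_range: "1 \<le> s \<Longrightarrow> s \<le> k \<Longrightarrow> i s \<in> {i 1..<i 1 + N}"
  using mono[of 1 s] mono[of s "k + 1"] period by (cases "s = 1") auto

lemma in_tail: "1 \<le> s \<Longrightarrow> s \<le> k \<Longrightarrow> i s \<in> set (map i [l + 1..<k + 1] @ map i [1..<l + 1])"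
proof -
  assume "1 \<le> s" "s \<le> k"
  then have "s \<in> set [l + 1..<k + 1] \<or> s \<in> set [1..<l + 1]" by auto
  then show ?thesis unfolding set_append set_map by blast
qed

lemma letter_cases:
  assumes "x \<in> set w"
  obtains (tail) s where "1 \<le> s" "s \<le> k" "x = i s"
  | (chunk) s where "1 \<le> s" "s \<le> k" "i s < x" "x < i (s + 1)"
proof -
  obtain s where "1 \<le> s" "s \<le> k" "i s \<le> x" "x < i (s + 1)"
    using find_chunk[of x] assms period by (auto simp: set_w)
  then show ?thesis using that by (cases "x = i s") auto
qed

lemma chunk_before_tail:
  assumes "1 \<le> s" "s \<le> k" "i s < x" "x < i (s + 1)" "1 \<le> t" "t \<le> k"
  shows "occurs_after w x (i t)"
proof -
  have "x \<in> set (rev [i s + 1..<i (s + 1)])" using assms by simp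
  moreover have "s = k \<or> s \<in> set [1..<k]" using assms by auto
  ultimately have "x \<in> set (rev [i k + 1..<i (k + 1)]
      @ concat (map (\<lambda>s. rev [i s + 1..<i (s + 1)]) [1..<k]))"
    unfolding set_append set_concat set_map by blast
  from occurs_after_append[OF this in_tail[OF assms(5,6)]] show ?thesis
    by (simp add: loop_word_def)
qed

lemma chunk_descends:
  assumes "1 \<le> s" "s \<le> k" "i s + 1 < x" "x < i (s + 1)"
  shows "occurs_after w x (x - 1)"
proof -
  have *: "occurs_after (rev [i s + 1..<i (s + 1)]) x (x - 1)"
    using assms by (intro occurs_after_rev_upt) auto
  show ?thesis
  proof (cases "s = k")
    case True
    then show ?thesis using * unfolding loop_word_def by (auto intro: occurs_after_appendI1)
  next
    case False
    then have "s \<in> set [1..<k]" using assms by auto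
    then have "occurs_after (concat (map (\<lambda>s. rev [i s + 1..<i (s + 1)]) [1..<k])) x (x - 1)"
      using * by (intro occurs_after_concat[of "rev [i s + 1..<i (s + 1)]"]) auto
    then show ?thesis unfolding loop_word_def
      by (intro occurs_after_appendI2 occurs_after_appendI1)
  qed
qed

text \<open>
  If two indices are cyclic neighbours, then the later one has to make way first. The tail starts behind
  the index \<open>i l\<close>, and this cut is harmless since \<open>i l\<close> is a gap.
\<close>

lemma tail_cyclic:
  assumes "1 \<le> s" "s \<le> k" "1 \<le> t" "t \<le> k" "(i s + 1) mod N = i t mod N"
  shows "occurs_after w (i s) (i t)"
proof -
  have in_w: "occurs_after w x y"
    if "occurs_after (map i [l + 1..<k + 1] @ map i [1..<l + 1]) x y" for x y
    unfolding loop_word_def by (intro occurs_after_appendI2 that)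
  show ?thesis
  proof (cases "i s + 1 = i (k + 1)")
    case True
    have "\<not> s < k"
    proof
      assume "s < k"
      then have "i s < i k" "i k < i (k + 1)" using mono[of s k] step[of k] assms(1) by auto
      then show False using True by simp
    qed
    then have sk: "s = k" using assms(2) by linarith
    have "i t mod N = i 1 mod N" using assms(5) True period by simp
    have "1 \<le> k" using l by simp
    have "i t = i 1"
      by (rule mod_inj[OF indices_in_range indices_in_range \<open>i t mod N = i 1 mod N\<close>])
        (use assms \<open>1 \<le> k\<close> in simp_all)
    then have "t = 1" using inj[of t 1] assms by simp
    moreover have "l < k" using gap sk True l by (cases "l = k") auto
    moreover have "k \<in> set [l + 1..<k + 1]" "1 \<in> set [1..<l + 1]" using \<open>l < k\<close> l by auto
    ultimately have "occurs_after (map i [l + 1..<k + 1] @ map i [1..<l + 1]) (i s) (i t)"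
      unfolding sk by (intro occurs_after_append) (simp_all only: set_map imageI)
    then show ?thesis by (rule in_w)
  next
    case False
    have "i s < i (k + 1)" using mono[of s "k + 1"] assms by simp
    then have "i s + 1 \<in> {i 1..<i 1 + N}"
      using False indices_in_range[of s] assms period by auto
    then have st: "i s + 1 = i t"
      by (rule mod_inj[OF _ indices_in_range[OF assms(3,4)] assms(5)])
    have "s < t" using mono[of t s] st assms by (cases s t rule: linorder_cases) auto
    moreover have "\<not> s + 1 < t" using mono[of s "s + 1"] mono[of "s + 1" t] st assms by auto
    ultimately have t: "t = s + 1" by simp
    have sl: "s \<noteq> l" using gap st t by auto
    have "occurs_after (map i [l + 1..<k + 1] @ map i [1..<l + 1]) (i s) (i t)"
    proof (cases "s < l")
      case True
      then show ?thesis using t assms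
        by (intro occurs_after_appendI2 occurs_after_upt) auto
    next
      case False
      then show ?thesis using t sl assms
        by (intro occurs_after_appendI1 occurs_after_upt) auto
    qed
    then show ?thesis by (rule in_w)
  qed
qed

text \<open>
  Every particle first takes one step, by the letters in the tail, and then walks by a descending chunk
  to the place of the next particle, which is free by then.
\<close>

lemma run_source: "run N letters_mod source \<noteq> None"
proof (rule run_distinct[OF distinct_mod _ N2])
  fix u j v assume split: "letters_mod = u @ j # v"
  then obtain u' x v' where w: "w = u' @ x # v'" "j = x mod N" "v = map (\<lambda>j. j mod N) v'"
    unfolding letters_mod_def map_eq_append_conv map_eq_Cons_conv by blast
  have after: "y mod N \<in> set v" if "occurs_after w x y" for y
    using occurs_after_split[of u' x v' y] distinct_w that w by auto
  have "x \<in> set w" using w by simp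
  then show "j \<in> source \<or> (\<exists>i\<in>set v. nx N i = j)" "nx N j \<notin> source \<or> nx N j \<in> set v"
  proof (atomize (full), cases rule: letter_cases)
    case (tail s)
    have "nx N j \<in> set v" if src: "nx N j \<in> source"
    proof -
      obtain t where t: "1 \<le> t" "t \<le> k" "nx N j = i t mod N" using src by (auto simp: source_def)
      then have "(i s + 1) mod N = i t mod N" using w(2) tail by (simp add: mod_Suc_eq)
      then show ?thesis using after tail_cyclic[of s t] tail t by simp
    qed
    moreover have "j \<in> source" using tail w by (auto simp: source_def)
    ultimately show "(j \<in> source \<or> (\<exists>i\<in>set v. nx N i = j)) \<and> (nx N j \<notin> source \<or> nx N j \<in> set v)"
      by blast
  next
    case (chunk s)
    have "occurs_after w x (x - 1)"
    proof (cases "x = i s + 1")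
      case True
      then show ?thesis using chunk_before_tail[OF chunk, of s] chunk by simp
    next
      case False
      then show ?thesis using chunk by (intro chunk_descends[of s]) auto
    qed
    then have "(x - 1) mod N \<in> set v" by (rule after)
    moreover have "nx N ((x - 1) mod N) = j" using chunk w(2) by (simp add: mod_Suc_eq)
    moreover have "nx N j \<in> set v" if src: "nx N j \<in> source"
    proof -
      obtain t where t: "1 \<le> t" "t \<le> k" "nx N j = i t mod N" using src by (auto simp: source_def)
      then show ?thesis using after chunk_before_tail[OF chunk, of t] by simp
    qed
    ultimately show "(j \<in> source \<or> (\<exists>i\<in>set v. nx N i = j)) \<and> (nx N j \<notin> source \<or> nx N j \<in> set v)"
      by blast
  qed
qed (simp add: set_mod)

lemma source_subset: "source \<subseteq> {..<N}"
  using N2 by (auto simp: source_def)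

lemma count_letters_mod:
  assumes "x < N"
  shows "count_list letters_mod x = 1"
proof -
  have "count_list xs x = (if x \<in> set xs then 1 else 0)" if "distinct xs" for xs
    using that by (induction xs) auto
  then show ?thesis using distinct_mod set_mod assms by simp
qed

text \<open>
  All letters occur equally often, so the run is closed; all places are affected, so the source is
  unique.
\<close>

lemma run_letters_mod:
  assumes "S \<subseteq> {..<N}"
  shows "run N letters_mod S = Some T \<longleftrightarrow> S = source \<and> T = source"
proof -
  have stay: "T = source" if T: "run N letters_mod source = Some T" for T
  proof -
    have "x \<in> T \<longleftrightarrow> x \<in> source" if x: "x < N" for x
    proof -
      obtain j where j: "j < N" "x = nx N j" using nx_surj[OF x] by metis
      note one = count_letters_mod
      have "of_bool (x \<in> T) + count_list letters_mod x = of_bool (x \<in> source) + count_list letters_mod j"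
        using run_count[OF T _ N2 j(1)] set_mod j(2) by simp
      then show ?thesis using one[OF x] one[OF j(1)] by (cases "x \<in> T"; cases "x \<in> source"; simp)
    qed
    moreover have "T \<subseteq> {..<N}" using run_subset[OF T source_subset] N2 by simp
    ultimately show ?thesis using source_subset by blast
  qed
  have "S = source" if "run N letters_mod S = Some T"
    using run_source_unique_full[OF _ run_source set_mod N2 assms source_subset] that by simp
  then show ?thesis using stay run_source by auto
qed

lemma count_0_letters_mod: "count_list letters_mod 0 = 1"
  using count_letters_mod[of 0] N2 by simp

end

lemma cyclic_indices_idx:
  assumes "J \<subseteq> {1..N}" "1 \<le> card J" "l \<in> gaps N J" "N \<ge> 2"
  shows "cyclic_indices N (card J) l (idx N J)"
proof
  let ?xs = "sorted_list_of_set J"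
  have fin: "finite J" using assms(1) finite_subset by auto
  have len: "length ?xs = card J" by simp
  have mem: "?xs ! m \<in> {1..N}" if "m < card J" for m
    using nth_mem[of m ?xs] that assms(1) fin by auto
  fix s assume s: "1 \<le> s" "s \<le> card J"
  show "idx N J s < idx N J (s + 1)"
  proof (cases "s = card J")
    case True
    then show ?thesis using mem[of "s - 1"] mem[of 0] s by (auto simp: idx_def)
  next
    case False
    have "sorted_wrt (<) ?xs" by (rule strict_sorted_list_of_set)
    then show ?thesis using False s sorted_wrt_nth_less[of "(<)" ?xs "s - 1" s] by (simp add: idx_def)
  qed
qed (use assms in \<open>auto simp: idx_def gaps_def\<close>)

lemma idx_image:
  assumes "finite J"
  shows "idx N J ` {1..card J} = J"
proof -
  have "idx N J ` {1..card J} = (\<lambda>m. sorted_list_of_set J ! m) ` {..<card J}"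
  proof -
    have "{1..card J} = Suc ` {..<card J}" by (simp add: image_Suc_lessThan)
    then have "idx N J ` {1..card J} = (\<lambda>m. idx N J (Suc m)) ` {..<card J}"
      by (simp only: image_image)
    then show ?thesis by (simp only:) (rule image_cong, auto simp: idx_def)
  qed
  also have "\<dots> = set (sorted_list_of_set J)"
    unfolding set_conv_nth by auto
  also have "\<dots> = J" using assms by simp
  finally show ?thesis .
qed

context affine_nTL
begin

lemma monom_conv: "nTL_monom N js = coset (wd (map (\<lambda>j. j mod N) js))"
proof (induction js)
  case Nil
  then show ?case by (simp add: nTL_monom_def A_simps single_one[symmetric] zero_word_def del: single_one)
next
  case (Cons j js)
  have "nTL_monom N (j # js) = nTL_gen N j \<otimes>\<^bsub>A\<^esub> nTL_monom N js"
    by (simp add: nTL_monom_def)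
  also have "\<dots> = coset (wd [j mod N] * wd (map (\<lambda>j. j mod N) js))"
    unfolding Cons.IH gen_conv using wd_mod_mem[of "[j]"] wd_mod_mem[of js]
    by (intro A_simps) auto
  also have "wd [j mod N] * wd (map (\<lambda>j. j mod N) js) = wd (map (\<lambda>j. j mod N) (j # js))"
    by (simp add: mult_single plus_word_def)
  finally show ?case .
qed

lemma a_hat_mem: "a_hat N J l \<in> carrier A"
  unfolding a_hat_def Let_def monom_conv carrier_A using wd_mod_mem by blast

lemma rep_a_hat:
  assumes "J \<subseteq> {1..N}" "1 \<le> card J" "l \<in> gaps N J" "S \<subseteq> {..<N}"
  shows "rep (a_hat N J l) T S
    = (if S = (\<lambda>j. j mod N) ` J \<and> T = S then Polynomial.monom 1 1 else 0)"
proof -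
  interpret c: cyclic_indices N "card J" l "idx N J"
    by (rule cyclic_indices_idx) (use assms N2 in auto)
  have src: "c.source = (\<lambda>j. j mod N) ` J"
    unfolding c.source_def using idx_image[OF finite_subset[OF assms(1)], of N] by simp
  have "a_hat N J l = coset (wd c.letters_mod)"
    unfolding c.letters_mod_def loop_word_def a_hat_def Let_def monom_conv by simp
  moreover have "wd c.letters_mod \<in> words_alg N" by (intro wd_mem) (simp add: c.set_mod)
  ultimately show ?thesis
    using assms(4) c.run_letters_mod[OF assms(4), of T] c.count_0_letters_mod
    by (auto simp: rep_coset entry_def src)
qed

lemma rep_scalar_mult:
  assumes "b \<in> carrier A" "T \<subseteq> {..<N}" "S \<subseteq> {..<N}"
  shows "rep (scal c \<otimes>\<^bsub>A\<^esub> b) T S = smult c (rep b T S)"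
proof -
  have "rep (scal c \<otimes>\<^bsub>A\<^esub> b) T S = (\<Sum>U\<in>Pow {..<N}. if U = T then smult c (rep b U S) else 0)"
    unfolding rep_mult[OF scalar_mem assms(1,3)] using assms by (intro sum.cong) (auto simp: rep_scalar)
  then show ?thesis using assms(2) by (simp add: sum.delta)
qed

text \<open>
  Reduction modulo \<open>N\<close> identifies the subsets of \<open>{1..N}\<close> with the configurations, so exactly one index
  set belongs to each configuration.
\<close>

lemma mod_image_iff:
  assumes "J \<subseteq> {1..N}" "S \<subseteq> {..<N}"
  shows "S = (\<lambda>j. j mod N) ` J \<longleftrightarrow> J = (\<lambda>j. if j = 0 then N else j) ` S"
proof
  assume S: "S = (\<lambda>j. j mod N) ` J"
  have "(if j mod N = 0 then N else j mod N) = j" if "j \<in> J" for j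
    using that assms(1) by (cases "j = N") auto
  then show "J = (\<lambda>j. if j = 0 then N else j) ` S" unfolding S image_image by simp
next
  assume J: "J = (\<lambda>j. if j = 0 then N else j) ` S"
  have "(if j = 0 then N else j) mod N = j" if "j \<in> S" for j
    using that assms(2) by auto
  then show "S = (\<lambda>j. j mod N) ` J" unfolding J image_image by simp
qed

lemma t_elem_mem: "t_elem N gap k \<in> carrier A"
  unfolding t_elem_def using a_hat_mem by (intro A.m_closed scalar_mem A.finsum_closed) auto

lemma rep_t_elem:
  assumes gap: "\<And>J. J \<subseteq> {1..N} \<Longrightarrow> 1 \<le> card J \<Longrightarrow> card J \<le> N - 1 \<Longrightarrow> gap J \<in> gaps N J"
    and k: "k \<in> {1..N - 1}" and TS: "T \<subseteq> {..<N}" "S \<subseteq> {..<N}"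
  shows "rep (t_elem N gap k) T S
    = (if T = S then if card S = k then Polynomial.monom ((- 1) ^ (k - 1)) 1 else 0 else 0)"
proof -
  let ?F = "{J. J \<subseteq> {1..N} \<and> card J = k}"
  let ?J = "(\<lambda>j. if j = 0 then N else j) ` S"
  have fin: "finite ?F" by (rule finite_subset[of _ "Pow {1..N}"]) auto
  have closed: "finsum A (\<lambda>J. a_hat N J (gap J)) ?F \<in> carrier A"
    by (intro A.finsum_closed) (auto simp: a_hat_mem)
  have "inj_on (\<lambda>j. if j = 0 then N else j) S" using TS(2) by (auto intro!: inj_onI split: if_splits)
  then have cardJ: "card ?J = card S" by (rule card_image)
  have subJ: "?J \<subseteq> {1..N}" using TS(2) N_pos by auto
  have "rep (finsum A (\<lambda>J. a_hat N J (gap J)) ?F) T S = (\<Sum>J\<in>?F. rep (a_hat N J (gap J)) T S)"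
    by (rule rep_finsum[OF _ TS(2) fin]) (rule a_hat_mem)
  also have "\<dots> = (\<Sum>J\<in>?F. if J = ?J then if T = S then Polynomial.monom 1 1 else 0 else 0)"
  proof (rule sum.cong)
    fix J assume J: "J \<in> ?F"
    then have "rep (a_hat N J (gap J)) T S
        = (if S = (\<lambda>j. j mod N) ` J \<and> T = S then Polynomial.monom 1 1 else 0)"
      using gap[of J] k TS(2) by (intro rep_a_hat) auto
    then show "rep (a_hat N J (gap J)) T S
        = (if J = ?J then if T = S then Polynomial.monom 1 1 else 0 else 0)"
      using mod_image_iff[of J S] J TS(2) by simp
  qed simp
  also have "\<dots> = (if ?J \<in> ?F then if T = S then Polynomial.monom 1 1 else 0 else 0)"
    by (rule sum.delta[OF fin])
  also have "\<dots> = (if T = S then if card S = k then Polynomial.monom 1 1 else 0 else 0)"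
    using cardJ subJ by auto
  finally show ?thesis
    unfolding t_elem_def using rep_scalar_mult[OF closed TS] by (simp add: smult_monom)
qed

end


section \<open>The center and its generators\<close>

lemma (in ring) subring_finsum:
  assumes "subring K R" "finite F" "\<And>x. x \<in> F \<Longrightarrow> f x \<in> K"
  shows "finsum R f F \<in> K"
  using assms(2,3)
proof (induction F rule: finite_induct)
  case empty then show ?case using subringE(2)[OF assms(1)] by simp
next
  case (insert x F)
  have "f \<in> F \<rightarrow> carrier R" "f x \<in> carrier R" using insert.prems subringE(1)[OF assms(1)] by auto
  then have "finsum R f (insert x F) = f x \<oplus> finsum R f F" using insert.hyps by simp
  then show ?case using insert subringE(7)[OF assms(1)] by simp
qed

locale affine_nTL_gaps = affine_nTL N I for N and I :: "(word \<Rightarrow>\<^sub>0 'k::field) set" +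
  fixes gap :: "nat set \<Rightarrow> nat"
  assumes gap: "\<And>J. J \<subseteq> {1..N} \<Longrightarrow> 1 \<le> card J \<Longrightarrow> card J \<le> N - 1 \<Longrightarrow> gap J \<in> gaps N J"
begin

abbreviation t :: "nat \<Rightarrow> (word \<Rightarrow>\<^sub>0 'k) set" where "t \<equiv> t_elem N gap"
abbreviation sgn_q :: "nat \<Rightarrow> 'k poly" where "sgn_q k \<equiv> [:0, (- 1) ^ (k - 1):]"
abbreviation V :: "nat \<Rightarrow> (word \<Rightarrow>\<^sub>0 'k) set set" where "V \<equiv> C_summand N gap"

lemma sgn_q_conv: "Polynomial.monom ((- 1) ^ (k - 1)) 1 = sgn_q k"
  by (simp add: monom_altdef)

lemma sgn_q_mult: "sgn_q k * ([:(- 1) ^ (k - 1):] * p) = pCons 0 p"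
  by (simp flip: power_add mult_2)

lemma rep_t:
  assumes "k \<in> {1..N - 1}" "T \<subseteq> {..<N}" "S \<subseteq> {..<N}"
  shows "rep (t k) T S = (if T = S then if card S = k then sgn_q k else 0 else 0)"
  unfolding sgn_q_conv[symmetric] by (rule rep_t_elem[OF gap assms])

lemma t_center: "k \<in> {1..N - 1} \<Longrightarrow> t k \<in> Z"
  by (rule centerI[where f = "\<lambda>m. if m = k then sgn_q k else 0"])
    (simp_all add: t_elem_mem rep_t)

lemma chi_t: "k \<in> {1..N - 1} \<Longrightarrow> j \<le> N \<Longrightarrow> chi j (t k) = (if j = k then sgn_q k else 0)"
  by (simp add: chi_def rep_t)

lemma subring_Z: "subring Z A"
  by (rule A.subring_ring_center)

lemmas Z_closed = subringE(2-7)[OF subring_Z]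

lemma subring_gen: "S \<subseteq> carrier A \<Longrightarrow> subring (gen_subalgebra A scal S) A"
  unfolding gen_subalgebra_def using scalar_mem by (intro A.generate_ring_is_subring) auto

lemma gen_subset_Z: "S \<subseteq> Z \<Longrightarrow> gen_subalgebra A scal S \<subseteq> Z"
  unfolding gen_subalgebra_def using scalar_mem scalar_center Z_carrier
  by (intro A.generate_ring_min_subring1 subring_Z) auto

lemma gen_base: "scal c \<in> gen_subalgebra A scal S" "x \<in> S \<Longrightarrow> x \<in> gen_subalgebra A scal S"
  unfolding gen_subalgebra_def by (auto intro: generate_ring.incl)

lemma gen_mono: "S \<subseteq> S' \<Longrightarrow> S' \<subseteq> carrier A \<Longrightarrow> gen_subalgebra A scal S \<subseteq> gen_subalgebra A scal S'"
  unfolding gen_subalgebra_def using scalar_mem by (intro A.mono_generate_ring) auto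

abbreviation P :: "nat \<Rightarrow> (word \<Rightarrow>\<^sub>0 'k) set set" where
  "P k \<equiv> gen_subalgebra A scal {t k}"

lemma P_subset_Z: "k \<in> {1..N - 1} \<Longrightarrow> P k \<subseteq> Z"
  using t_center by (intro gen_subset_Z) simp

lemma subring_P: "subring (P k) A"
  using t_elem_mem by (intro subring_gen) simp

text \<open>
  A polynomial in \<open>t k\<close> acts by its constant term wherever \<open>t k\<close> acts by zero.
\<close>

lemma chi_P_off_diagonal:
  assumes k: "k \<in> {1..N - 1}" and "a \<in> P k" and j: "j \<le> N" "j \<noteq> k"
  shows "chi j a = [:Polynomial.coeff (chi k a) 0:]"
proof -
  have kN: "k \<le> N" using k by auto
  have "a \<in> Z \<and> chi j a = [:Polynomial.coeff (chi k a) 0:]"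
    using assms(2) unfolding gen_subalgebra_def
  proof (induction rule: generate_ring.induct)
    case one then show ?case using j kN Z_closed(2) by (simp add: chi_one one_pCons)
  next
    case (incl h)
    then show ?case
      using j kN k t_center by (auto simp: chi_scalar scalar_center chi_t)
  next
    case (a_inv h)
    then show ?case using j kN Z_closed(4) Z_carrier by (simp add: chi_uminus)
  next
    case (eng_add h h')
    then show ?case using j kN Z_closed(6) Z_carrier by (simp add: chi_add)
  next
    case (eng_mult h h')
    then show ?case using j kN Z_closed(5) Z_carrier by (simp add: chi_mult coeff_mult_0)
  qed
  then show ?thesis ..
qed

text \<open>
  Horner's scheme; the factor \<open>scal ((- 1) ^ (k - 1))\<close> cancels the sign of \<open>t k\<close>.
\<close>

lemma chi_P_surj:
  assumes k: "k \<in> {1..N - 1}"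
  shows "\<exists>a\<in>P k. chi k a = p"
proof (induction p)
  case 0
  have "chi k (scal 0) = 0" using k by (auto simp: chi_scalar)
  then show ?case using gen_base(1) by blast
next
  case (pCons c p)
  then obtain a where a: "a \<in> P k" "chi k a = p" by blast
  let ?b = "scal c \<oplus>\<^bsub>A\<^esub> t k \<otimes>\<^bsub>A\<^esub> (scal ((- 1) ^ (k - 1)) \<otimes>\<^bsub>A\<^esub> a)"
  have "?b \<in> P k"
    using a gen_base by (intro subringE(6,7)[OF subring_P]) auto
  moreover have "chi k ?b = pCons c p"
  proof -
    have aA: "a \<in> carrier A" using a(1) P_subset_Z[OF k] Z_carrier by blast
    have kN: "k \<le> N" using k by auto
    have "chi k ?b = [:c:] + sgn_q k * ([:(- 1) ^ (k - 1):] * p)"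
      using k kN a(2) aA t_center[OF k] scalar_center scalar_mem t_elem_mem
      by (simp add: chi_add chi_mult chi_scalar chi_t del: mult_pCons_left mult_pCons_right)
    then show ?thesis unfolding sgn_q_mult by simp
  qed
  ultimately show ?case by blast
qed

lemma V_0: "V 0 = range scal"
  by (simp add: C_summand_def)

lemma V_pos: "j \<noteq> 0 \<Longrightarrow> V j = (\<lambda>x. t j \<otimes>\<^bsub>A\<^esub> x) ` P j"
  by (simp add: C_summand_def)

text \<open>
  Under \<^const>\<open>chi\<close>, the summand \<open>V j\<close> becomes the set of multiples of \<open>q\<close> in the \<open>j\<close>-th component, by
  this lemma and the next one.
\<close>

lemma V_pos_chi:
  assumes "j \<in> {1..N - 1}" "a \<in> V j"
  shows "a \<in> P j" "i \<le> N \<Longrightarrow> i \<noteq> j \<Longrightarrow> chi i a = 0" "Polynomial.coeff (chi j a) 0 = 0"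
proof -
  obtain b where b: "b \<in> P j" "a = t j \<otimes>\<^bsub>A\<^esub> b"
    using assms V_pos[of j] by auto
  then show "a \<in> P j" using gen_base subringE(6)[OF subring_P] by auto
  have bA: "b \<in> carrier A" using b(1) P_subset_Z[OF assms(1)] Z_carrier by blast
  have jN: "j \<le> N" using assms by auto
  show "chi i a = 0" if "i \<le> N" "i \<noteq> j"
    using that b bA assms by (simp add: chi_mult t_center chi_t)
  show "Polynomial.coeff (chi j a) 0 = 0"
    using b bA assms jN by (auto simp add: chi_mult t_center chi_t)
qed

lemma V_pos_surj:
  assumes "j \<in> {1..N - 1}"
  shows "\<exists>a\<in>V j. chi j a = pCons 0 p"
proof -
  obtain b where b: "b \<in> P j" "chi j b = p" using chi_P_surj[OF assms] by blast
  let ?e = "scal ((- 1) ^ (j - 1))"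
  have bA: "b \<in> carrier A" using b(1) P_subset_Z[OF assms] Z_carrier by blast
  have jN: "j \<le> N" using assms by auto
  have "?e \<otimes>\<^bsub>A\<^esub> b \<in> P j" using b(1) gen_base(1) by (intro subringE(6)[OF subring_P])
  then have "t j \<otimes>\<^bsub>A\<^esub> (?e \<otimes>\<^bsub>A\<^esub> b) \<in> V j" using assms by (simp add: V_pos)
  moreover have "chi j (t j \<otimes>\<^bsub>A\<^esub> (?e \<otimes>\<^bsub>A\<^esub> b)) = sgn_q j * ([:(- 1) ^ (j - 1):] * p)"
    using assms jN b(2) bA t_center[OF assms] scalar_center scalar_mem t_elem_mem
    by (simp add: chi_mult chi_scalar chi_t del: mult_pCons_left mult_pCons_right)
  ultimately show ?thesis unfolding sgn_q_mult by blast
qed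

lemma V_subset_Z: "j \<in> {0..N - 1} \<Longrightarrow> V j \<subseteq> Z"
  using V_pos_chi(1)[of j] P_subset_Z[of j] scalar_center V_0 by (cases "j = 0") auto

lemma chi_sum_V:
  assumes f: "f \<in> Pi\<^sub>E {0..N - 1} V" and j: "j \<in> {1..N - 1}"
  shows "chi j (finsum A f {0..N - 1}) = chi j (f 0) + chi j (f j)"
proof -
  have mem: "f i \<in> V i" if "i \<in> {0..N - 1}" for i using f that by auto
  have "chi j (finsum A f {0..N - 1}) = (\<Sum>i\<in>{0..N - 1}. chi j (f i))"
    using mem V_subset_Z Z_carrier j by (intro chi_finsum) auto
  also have "\<dots> = (\<Sum>i\<in>{0, j}. chi j (f i))"
  proof (rule sum.mono_neutral_right)
    show "\<forall>i\<in>{0..N - 1} - {0, j}. chi j (f i) = 0"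
    proof
      fix i assume i: "i \<in> {0..N - 1} - {0, j}"
      then have "i \<in> {1..N - 1}" by auto
      then show "chi j (f i) = 0" using V_pos_chi(2)[of i "f i" j] mem[of i] i j by auto
    qed
  qed (use j in auto)
  finally show ?thesis using j by auto
qed

text \<open>
  Together with \<open>center_eqI\<close> this shows that \<^const>\<open>chi\<close> identifies the center with the families of
  \<open>N - 1\<close> polynomials that have a common constant coefficient \<open>c\<close>.
\<close>

lemma sum_V_with_chi:
  obtains f where "f \<in> Pi\<^sub>E {0..N - 1} V"
    "\<And>j. j \<in> {1..N - 1} \<Longrightarrow> chi j (finsum A f {0..N - 1}) = pCons c (p j)"
proof -
  have "\<forall>j\<in>{1..N - 1}. \<exists>a\<in>V j. chi j a = pCons 0 (p j)" using V_pos_surj by blast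
  then obtain g where g: "\<And>j. j \<in> {1..N - 1} \<Longrightarrow> g j \<in> V j \<and> chi j (g j) = pCons 0 (p j)"
    by metis
  define f where "f = restrict (\<lambda>j. if j = 0 then scal c else g j) {0..N - 1}"
  have f: "f \<in> Pi\<^sub>E {0..N - 1} V" using g by (auto simp: f_def V_0)
  moreover have "chi j (finsum A f {0..N - 1}) = pCons c (p j)" if "j \<in> {1..N - 1}" for j
    using chi_sum_V[OF f that] g[OF that] that by (auto simp: f_def chi_scalar)
  ultimately show ?thesis by (rule that)
qed

lemma finsum_V_center: "f \<in> Pi\<^sub>E {0..N - 1} V \<Longrightarrow> finsum A f {0..N - 1} \<in> Z"
  by (rule A.subring_finsum[OF subring_Z]) (auto dest!: PiE_mem intro: subsetD[OF V_subset_Z])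

lemma center_with_chi:
  "\<exists>a\<in>Z. \<forall>j\<in>{1..N - 1}. chi j a = pCons c (p j)"
  using sum_V_with_chi[where c = c and p = p] finsum_V_center by metis

lemma chi_center_split:
  assumes "a \<in> Z"
  shows "\<exists>c p. \<forall>j\<in>{1..N - 1}. chi j a = pCons c (p j)"
proof -
  define c where "c = Polynomial.coeff (chi 1 a) 0"
  have "\<exists>p. chi j a = pCons c p" if "j \<in> {1..N - 1}" for j
  proof -
    obtain d p where dp: "chi j a = pCons d p" by (cases "chi j a")
    then have "d = c"
      using chi_coeff_0[OF Z_carrier[OF assms], of j 1] that N by (auto simp: c_def)
    then show ?thesis using dp by blast
  qed
  then have "\<forall>j\<in>{1..N - 1}. \<exists>p. chi j a = pCons c p" by blast
  then obtain p where "\<forall>j\<in>{1..N - 1}. chi j a = pCons c (p j)" by metis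
  then show ?thesis by blast
qed

lemma center_as_sum:
  assumes "a \<in> Z"
  obtains f where "f \<in> Pi\<^sub>E {0..N - 1} V" "a = finsum A f {0..N - 1}"
proof -
  obtain c p where cp: "\<And>j. j \<in> {1..N - 1} \<Longrightarrow> chi j a = pCons c (p j)"
    using chi_center_split[OF assms] by blast
  obtain f where f: "f \<in> Pi\<^sub>E {0..N - 1} V"
    "\<And>j. j \<in> {1..N - 1} \<Longrightarrow> chi j (finsum A f {0..N - 1}) = pCons c (p j)"
    using sum_V_with_chi[where c = c and p = p] by metis
  have "a = finsum A f {0..N - 1}"
    using assms finsum_V_center[OF f(1)] cp f(2) by (intro center_eqI) auto
  then show ?thesis using f(1) that by blast
qed

theorem center_eq_C_alg: "Z = C_alg N gap"
proof
  show "Z \<subseteq> C_alg N gap"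
    unfolding C_alg_def sum_of_subspaces_def using center_as_sum by blast
  show "C_alg N gap \<subseteq> Z"
    unfolding C_alg_def sum_of_subspaces_def using finsum_V_center by blast
qed

theorem center_generated: "Z = gen_subalgebra A scal (insert \<one>\<^bsub>A\<^esub> (t ` {1..N - 1}))"
proof
  let ?S = "insert \<one>\<^bsub>A\<^esub> (t ` {1..N - 1})"
  have S: "?S \<subseteq> carrier A" using t_elem_mem by auto
  show "gen_subalgebra A scal ?S \<subseteq> Z"
    using t_center Z_closed(2) by (intro gen_subset_Z) auto
  show "Z \<subseteq> gen_subalgebra A scal ?S"
  proof
    fix a assume "a \<in> Z"
    then obtain f where f: "f \<in> Pi\<^sub>E {0..N - 1} V" "a = finsum A f {0..N - 1}"
      by (rule center_as_sum)
    have "f j \<in> gen_subalgebra A scal ?S" if j: "j \<in> {0..N - 1}" for j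
    proof (cases "j = 0")
      case True
      then have "f j \<in> range scal" using PiE_mem[OF f(1) j] V_0 by simp
      then show ?thesis using gen_base(1) by auto
    next
      case False
      then have "j \<in> {1..N - 1}" using j by auto
      then have "f j \<in> P j" using PiE_mem[OF f(1) j] V_pos_chi(1) by blast
      moreover have "P j \<subseteq> gen_subalgebra A scal ?S"
        using \<open>j \<in> {1..N - 1}\<close> S by (intro gen_mono) auto
      ultimately show ?thesis by blast
    qed
    then show "a \<in> gen_subalgebra A scal ?S"
      unfolding f(2) by (intro A.subring_finsum subring_gen S) auto
  qed
qed

theorem t_orthogonal:
  assumes "k \<in> {1..N - 1}" "l \<in> {1..N - 1}" "k \<noteq> l"
  shows "t k \<otimes>\<^bsub>A\<^esub> t l = \<zero>\<^bsub>A\<^esub>"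
proof (rule center_eqI)
  show "t k \<otimes>\<^bsub>A\<^esub> t l \<in> Z" "\<zero>\<^bsub>A\<^esub> \<in> Z" using assms t_center Z_closed(1,5) by auto
  show "chi j (t k \<otimes>\<^bsub>A\<^esub> t l) = chi j \<zero>\<^bsub>A\<^esub>" if "j \<in> {1..N - 1}" for j
  proof -
    have "j \<le> N" "{..<j} \<subseteq> {..<N}" using that by auto
    then show ?thesis
      using assms t_center t_elem_mem rep_zero by (auto simp: chi_mult chi_t chi_def[of _ "\<zero>\<^bsub>A\<^esub>"])
  qed
qed

theorem t_polynomial_ring:
  assumes k: "k \<in> {1..N - 1}"
  shows "chi k \<in> alg_iso (A\<lparr>carrier := P k\<rparr>) scal (ring_on (UNIV :: 'k poly set)) (\<lambda>c. [:c:])"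
proof -
  have kN: "k \<le> N" using k by auto
  have mem: "a \<in> Z" "a \<in> carrier A" if "a \<in> P k" for a
    using that P_subset_Z[OF k] Z_carrier by auto
  have "inj_on (chi k) (P k)"
  proof (rule inj_onI)
    fix a b assume ab: "a \<in> P k" "b \<in> P k" "chi k a = chi k b"
    show "a = b"
    proof (rule center_eqI)
      show "chi j a = chi j b" if "j \<in> {1..N - 1}" for j
        using that ab chi_P_off_diagonal[OF k, of _ j] by (cases "j = k") auto
    qed (use ab mem in auto)
  qed
  moreover have "chi k ` P k = UNIV" using chi_P_surj[OF k] by (auto simp: image_iff) metis
  ultimately have "bij_betw (chi k) (P k) UNIV" by (simp add: bij_betw_def)
  then have "chi k \<in> ring_iso (A\<lparr>carrier := P k\<rparr>) (ring_on UNIV)"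
    by (intro ring_iso_memI)
      (auto simp: ring_on_def chi_mult chi_add chi_one kN mem)
  then show ?thesis by (simp add: alg_iso_def chi_scalar kN)
qed

lemma scalar_ring_ops:
  "scal c \<oplus>\<^bsub>A\<^esub> scal d = scal (c + d)" "scal c \<otimes>\<^bsub>A\<^esub> scal d = scal (c * d)"
  unfolding scalar_conv A_simps(3)[OF single_0_mem single_0_mem]
    A_simps(4)[OF single_0_mem single_0_mem] by (simp_all add: single_add mult_single)

lemma scalar_uminus: "\<ominus>\<^bsub>A\<^esub> scal c = scal (- c)"
proof (rule A.minus_equality)
  show "scal (- c) \<oplus>\<^bsub>A\<^esub> scal c = \<zero>\<^bsub>A\<^esub>"
    unfolding scalar_ring_ops by (simp add: scalar_conv A_simps)
qed (rule scalar_mem)+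

lemma subspace_V:
  assumes "j \<in> {0..N - 1}"
  shows "subalgebra (range scal) (V j) A"
proof (rule subalgebra.intro)
  have grp: "Group.group (add_monoid A)" by (rule A.add.is_group)
  show "subgroup (V j) (add_monoid A)"
  proof (cases "j = 0")
    case True
    show ?thesis unfolding True V_0
    proof (rule group.subgroupI[OF grp])
      show "inv\<^bsub>add_monoid A\<^esub> a \<in> range scal" if "a \<in> range scal" for a
        using that unfolding a_inv_def[symmetric] by (auto simp: scalar_uminus)
    qed (auto simp: scalar_mem scalar_ring_ops)
  next
    case False
    note sub = subringE[OF subring_P[of j]]
    have carr: "a \<in> carrier A" if "a \<in> P j" for a using sub(1) that by auto
    show ?thesis unfolding V_pos[OF False]
    proof (rule group.subgroupI[OF grp])
      show "(\<lambda>x. t j \<otimes>\<^bsub>A\<^esub> x) ` P j \<subseteq> carrier (add_monoid A)" using carr t_elem_mem by auto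
      show "(\<lambda>x. t j \<otimes>\<^bsub>A\<^esub> x) ` P j \<noteq> {}" using sub(2) by auto
      show "inv\<^bsub>add_monoid A\<^esub> a \<in> (\<lambda>x. t j \<otimes>\<^bsub>A\<^esub> x) ` P j"
        if "a \<in> (\<lambda>x. t j \<otimes>\<^bsub>A\<^esub> x) ` P j" for a
        using that sub(5) carr t_elem_mem unfolding a_inv_def[symmetric]
        by (auto simp: A.r_minus[symmetric])
      show "a \<otimes>\<^bsub>add_monoid A\<^esub> b \<in> (\<lambda>x. t j \<otimes>\<^bsub>A\<^esub> x) ` P j"
        if "a \<in> (\<lambda>x. t j \<otimes>\<^bsub>A\<^esub> x) ` P j" "b \<in> (\<lambda>x. t j \<otimes>\<^bsub>A\<^esub> x) ` P j" for a b
        using that sub(7) carr t_elem_mem by (auto simp: A.r_distr[symmetric])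
    qed
  qed
  show "subalgebra_axioms (range scal) (V j) A"
  proof
    fix c a assume c: "c \<in> range scal" and a: "a \<in> V j"
    show "c \<otimes>\<^bsub>A\<^esub> a \<in> V j"
    proof (cases "j = 0")
      case True
      then show ?thesis using c a by (auto simp: V_0 scalar_ring_ops)
    next
      case False
      then obtain b where b: "b \<in> P j" "a = t j \<otimes>\<^bsub>A\<^esub> b" using a V_pos by auto
      have carr: "b \<in> carrier A" "c \<in> carrier A"
        using b(1) c scalar_mem subringE(1)[OF subring_P] by auto
      have "c \<otimes>\<^bsub>A\<^esub> t j = t j \<otimes>\<^bsub>A\<^esub> c" using c scalar_center t_elem_mem by (auto simp: ring_center_def)
      then have "c \<otimes>\<^bsub>A\<^esub> a = t j \<otimes>\<^bsub>A\<^esub> (c \<otimes>\<^bsub>A\<^esub> b)"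
        unfolding b(2) using carr t_elem_mem by (metis A.m_assoc)
      moreover have "c \<otimes>\<^bsub>A\<^esub> b \<in> P j" using b(1) c gen_base(1) subringE(6)[OF subring_P] by auto
      ultimately show ?thesis unfolding V_pos[OF False] by blast
    qed
  qed
qed

theorem sum_V_direct: "sum_is_direct A scal {0..N - 1} V"
  unfolding sum_is_direct_def
proof (intro conjI ballI subspace_V inj_onI)
  fix f g assume f: "f \<in> Pi\<^sub>E {0..N - 1} V" and g: "g \<in> Pi\<^sub>E {0..N - 1} V"
    and eq: "finsum A f {0..N - 1} = finsum A g {0..N - 1}"
  have sum: "chi j (f 0) + chi j (f j) = chi j (g 0) + chi j (g j)" if "j \<in> {1..N - 1}" for j
    using chi_sum_V[OF f that] chi_sum_V[OF g that] eq by simp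
  have "f 0 \<in> range scal" "g 0 \<in> range scal"
    using PiE_mem[OF f, of 0] PiE_mem[OF g, of 0] V_0 by simp_all
  then obtain c d where cd: "f 0 = scal c" "g 0 = scal d" by blast
  have one: "1 \<in> {1..N - 1}" "1 \<in> {0..N - 1}" using N by auto
  have "Polynomial.coeff (chi 1 (f 1)) 0 = 0" "Polynomial.coeff (chi 1 (g 1)) 0 = 0"
    using V_pos_chi(3)[OF one(1)] PiE_mem[OF f one(2)] PiE_mem[OF g one(2)] by auto
  then have "c = d"
    using arg_cong[OF sum[OF one(1)], of "\<lambda>p. Polynomial.coeff p 0"] cd N by (simp add: chi_scalar)
  then have zero: "f 0 = g 0" using cd by simp
  have "f j = g j" if j: "j \<in> {0..N - 1}" for j
  proof (cases "j = 0")
    case True then show ?thesis using zero by simp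
  next
    case False
    then have j1: "j \<in> {1..N - 1}" using j by auto
    have fg: "f j \<in> V j" "g j \<in> V j" using PiE_mem[OF f j] PiE_mem[OF g j] by auto
    show ?thesis
    proof (rule center_eqI)
      show "f j \<in> Z" "g j \<in> Z" using fg V_subset_Z[OF j] by auto
      show "chi i (f j) = chi i (g j)" if "i \<in> {1..N - 1}" for i
        using sum[OF j1] zero V_pos_chi(2)[OF j1 fg(1), of i] V_pos_chi(2)[OF j1 fg(2), of i] that
        by (cases "i = j") auto
    qed
  qed
  then show "f = g" by (intro PiE_ext[OF f g])
qed

end


section \<open>The polynomial presentation of the center\<close>

definition mpolys :: "nat \<Rightarrow> ((nat \<Rightarrow>\<^sub>0 nat) \<Rightarrow>\<^sub>0 'k::field) set" where
  "mpolys N = {p. \<forall>m\<in>Poly_Mapping.keys p. Poly_Mapping.keys m \<subseteq> {1..N - 1}}"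

lemma mpoly_ring_conv: "mpoly_ring {1..N - 1} = ring_on (mpolys N)"
  by (simp add: mpoly_ring_def mpolys_def)

lemma single_mem_mpolys:
  "Poly_Mapping.keys m \<subseteq> {1..N - 1} \<Longrightarrow> Poly_Mapping.single m c \<in> mpolys N"
  by (auto simp: mpolys_def)

lemma mvar_mem: "k \<in> {1..N - 1} \<Longrightarrow> mvar k \<in> mpolys N"
  by (auto simp: mvar_def intro!: single_mem_mpolys)

lemma keys_add_nat:
  "Poly_Mapping.keys (m + n :: nat \<Rightarrow>\<^sub>0 nat) = Poly_Mapping.keys m \<union> Poly_Mapping.keys n"
  by (auto simp: in_keys_iff lookup_add)

lemma concrete_ring_mpolys: "concrete_ring (mpolys N :: ((nat \<Rightarrow>\<^sub>0 nat) \<Rightarrow>\<^sub>0 'k::field) set)"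
proof
  fix p q :: "(nat \<Rightarrow>\<^sub>0 nat) \<Rightarrow>\<^sub>0 'k" assume pq: "p \<in> mpolys N" "q \<in> mpolys N"
  then show "p + q \<in> mpolys N"
    using Poly_Mapping.keys_add[of p q] by (auto simp: mpolys_def)
  show "p * q \<in> mpolys N"
    unfolding mpolys_def
  proof (intro CollectI ballI)
    fix m assume "m \<in> Poly_Mapping.keys (p * q)"
    then obtain m1 m2 where "m = m1 + m2" "m1 \<in> Poly_Mapping.keys p" "m2 \<in> Poly_Mapping.keys q"
      using keys_mult[of p q] by blast
    then show "Poly_Mapping.keys m \<subseteq> {1..N - 1}"
      using pq by (auto simp: mpolys_def keys_add_nat)
  qed
next
  fix p :: "(nat \<Rightarrow>\<^sub>0 nat) \<Rightarrow>\<^sub>0 'k" assume "p \<in> mpolys N"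
  then show "- p \<in> mpolys N" by (auto simp: mpolys_def in_keys_iff)
qed (auto simp: mpolys_def in_keys_iff lookup_one when_def)

lemma cross_gens_subset:
  "{mvar k * mvar l | k l. k \<in> {1..N - 1} \<and> l \<in> {1..N - 1} \<and> k \<noteq> l} \<subseteq> mpolys N"
proof -
  interpret concrete_ring "mpolys N" by (rule concrete_ring_mpolys)
  show ?thesis using mvar_mem mult_mem by blast
qed

lemma concrete_quotient_cross: "concrete_quotient (mpolys N) (cross_ideal N)"
proof -
  interpret concrete_ring "mpolys N" by (rule concrete_ring_mpolys)
  have "ideal (cross_ideal N) (ring_on (mpolys N))"
    unfolding cross_ideal_def mpoly_ring_conv
    by (rule genideal_ideal) (simp only: ring_on_simps cross_gens_subset)
  then show ?thesis by (intro concrete_quotient.intro concrete_ring_mpolys)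
qed

text \<open>
  The image of a monomial under the evaluation that sends the \<open>j\<close>-th variable to \<open>e q\<close> and all others to
  zero. The scalar \<open>e\<close> will be the sign of \<open>t j\<close>.
\<close>

definition axis_monomial :: "'k::field \<Rightarrow> nat \<Rightarrow> (nat \<Rightarrow>\<^sub>0 nat) \<Rightarrow> 'k poly" where
  "axis_monomial e j m =
     (if Poly_Mapping.keys m \<subseteq> {j} then Polynomial.monom e 1 ^ Poly_Mapping.lookup m j else 0)"

definition psi :: "'k::field \<Rightarrow> nat \<Rightarrow> ((nat \<Rightarrow>\<^sub>0 nat) \<Rightarrow>\<^sub>0 'k) \<Rightarrow> 'k poly" where
  "psi e j = lin_ext (axis_monomial e j)"

lemma psi_simps [simp]:
  "psi e j 0 = 0" "psi e j (p + q) = psi e j p + psi e j q" "psi e j (- p) = - psi e j p"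
  "psi e j (p - q) = psi e j p - psi e j q"
  by (simp_all add: psi_def)

lemma psi_single: "psi e j (Poly_Mapping.single m c) = smult c (axis_monomial e j m)"
  by (simp add: psi_def)

lemma psi_mult: "psi e j (p * q) = psi e j p * psi e j q"
proof -
  have "axis_monomial e j (m + n) = (\<Sum>u\<in>{()}. axis_monomial e j m * axis_monomial e j n)" for m n
    by (auto simp: axis_monomial_def keys_add_nat lookup_add power_add)
  then have "lin_ext (axis_monomial e j) (p * q)
      = (\<Sum>u\<in>{()}. lin_ext (axis_monomial e j) p * lin_ext (axis_monomial e j) q)"
    by (rule lin_ext_mult)
  then show ?thesis by (simp add: psi_def)
qed

lemma psi_sum: "psi e j (\<Sum>x\<in>F. f x) = (\<Sum>x\<in>F. psi e j (f x))"
  by (simp add: psi_def lin_ext_sum)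

lemma psi_const: "psi e j (Poly_Mapping.single 0 c) = [:c:]"
  by (simp add: psi_single axis_monomial_def)

lemma psi_one: "psi e j 1 = 1"
  using psi_const[of e j 1] by (simp add: one_pCons)

lemma psi_mvar: "psi e j (mvar k) = (if j = k then [:0, e:] else 0)"
  by (simp add: mvar_def psi_single axis_monomial_def monom_altdef)

lemma monom_power: "Polynomial.monom e 1 ^ n = Polynomial.monom (e ^ n) n"
  by (induction n) (simp_all add: mult_monom one_pCons monom_0)

lemma axis_monomial_conv:
  "axis_monomial e j m = (if Poly_Mapping.keys m \<subseteq> {j}
     then Polynomial.monom (e ^ Poly_Mapping.lookup m j) (Poly_Mapping.lookup m j) else 0)"
  unfolding axis_monomial_def monom_power ..

lemma psi_coeff_0: "Polynomial.coeff (psi e j p) 0 = Poly_Mapping.lookup p 0"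
proof -
  have *: "Polynomial.coeff (axis_monomial e j m) 0 = (if m = 0 then 1 else 0)" for m
  proof (cases "Poly_Mapping.keys m \<subseteq> {j}")
    case True
    have "m = 0 \<longleftrightarrow> Poly_Mapping.lookup m j = 0"
    proof
      assume "Poly_Mapping.lookup m j = 0"
      then have "j \<notin> Poly_Mapping.keys m" by (simp add: in_keys_iff)
      then have "Poly_Mapping.keys m = {}" using True by blast
      then show "m = 0" by simp
    qed simp
    then show ?thesis using True by (auto simp: axis_monomial_conv)
  next
    case False
    then have "m \<noteq> 0" by auto
    then show ?thesis using False by (simp add: axis_monomial_def)
  qed
  have "Polynomial.coeff (psi e j p) 0
      = (\<Sum>m\<in>Poly_Mapping.keys p. if m = 0 then Poly_Mapping.lookup p m else 0)"
    unfolding psi_def lin_ext_def coeff_sum by (intro sum.cong) (auto simp: *)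
  then show ?thesis by (simp add: sum.delta in_keys_iff)
qed

text \<open>
  Distinct powers of the \<open>j\<close>-th variable contribute to distinct coefficients.
\<close>

lemma psi_coeff_axis:
  assumes "e \<noteq> 0" "Poly_Mapping.keys m \<subseteq> {j}" "psi e j p = 0"
  shows "Poly_Mapping.lookup p m = 0"
proof -
  let ?n = "Poly_Mapping.lookup m j"
  have eq: "m' = m" if "Poly_Mapping.keys m' \<subseteq> {j}" "Poly_Mapping.lookup m' j = ?n" for m'
  proof (rule poly_mapping_eqI)
    fix x
    show "Poly_Mapping.lookup m' x = Poly_Mapping.lookup m x"
    proof (cases "x = j")
      case False
      then have "x \<notin> Poly_Mapping.keys m'" "x \<notin> Poly_Mapping.keys m" using that(1) assms(2) by blast+
      then show ?thesis by (simp add: in_keys_iff)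
    qed (simp add: that(2))
  qed
  have "0 = Polynomial.coeff (psi e j p) ?n" using assms(3) by simp
  also have "\<dots> = (\<Sum>m'\<in>Poly_Mapping.keys p. if m' = m then Poly_Mapping.lookup p m' * e ^ ?n else 0)"
    unfolding psi_def lin_ext_def coeff_sum
    using eq assms(2) by (intro sum.cong) (auto simp: axis_monomial_conv)
  also have "\<dots> = Poly_Mapping.lookup p m * e ^ ?n" by (simp add: sum.delta in_keys_iff)
  finally show ?thesis using assms(1) by simp
qed

lemma mixed_monomial_in_cross_ideal:
  assumes "Poly_Mapping.keys m \<subseteq> {1..N - 1}" "k \<in> Poly_Mapping.keys m" "l \<in> Poly_Mapping.keys m" "k \<noteq> l"
  shows "Poly_Mapping.single m c \<in> cross_ideal N"
proof -
  interpret concrete_quotient "mpolys N" "cross_ideal N" by (rule concrete_quotient_cross)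
  let ?e = "\<lambda>k. Poly_Mapping.single k (1::nat)"
  let ?m = "m - ?e k - ?e l"
  have m: "m = ?e k + ?e l + ?m"
    using assms(2-4)
    by (intro poly_mapping_eqI) (auto simp: lookup_add lookup_minus lookup_single when_def in_keys_iff)
  have sub: "Poly_Mapping.keys ?m \<subseteq> Poly_Mapping.keys m"
    by (auto simp: in_keys_iff lookup_minus)
  have "mvar k * mvar l \<in> {mvar k * mvar l | k l. k \<in> {1..N - 1} \<and> l \<in> {1..N - 1} \<and> k \<noteq> l}"
    using assms by blast
  then have "mvar k * mvar l \<in> cross_ideal N"
    using genideal_self[of "{mvar k * mvar l | k l. k \<in> {1..N - 1} \<and> l \<in> {1..N - 1} \<and> k \<noteq> l}"]
      cross_gens_subset[of N]
    unfolding cross_ideal_def mpoly_ring_conv ring_on_simps by blast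
  moreover have "Poly_Mapping.single ?m c \<in> mpolys N"
    using sub assms(1) by (intro single_mem_mpolys) blast
  ultimately have "mvar k * mvar l * Poly_Mapping.single ?m c \<in> cross_ideal N" by (rule ideal_rmult)
  also have "mvar k * mvar l * Poly_Mapping.single ?m c = Poly_Mapping.single (?e k + ?e l + ?m) c"
    by (simp add: mvar_def mult_single)
  finally show ?thesis using m by simp
qed

text \<open>
  The evaluations on the coordinate axes see exactly the monomials with at most one variable, and all
  other monomials lie in the ideal.
\<close>

theorem cross_ideal_iff:
  assumes "N \<ge> 2" "\<And>j. j \<in> {1..N - 1} \<Longrightarrow> e j \<noteq> (0::'k::field)" "p \<in> mpolys N"
  shows "p \<in> cross_ideal N \<longleftrightarrow> (\<forall>j\<in>{1..N - 1}. psi (e j) j p = 0)"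
proof
  interpret concrete_quotient "mpolys N" "cross_ideal N" by (rule concrete_quotient_cross)
  let ?K = "{p \<in> mpolys N. \<forall>j\<in>{1..N - 1}. psi (e j) j p = 0}"
  have "ideal ?K (ring_on (mpolys N))"
    by (rule ideal_ring_onI) (auto simp: zero_mem add_mem uminus_mem mult_mem psi_mult)
  moreover have "{mvar k * mvar l | k l. k \<in> {1..N - 1} \<and> l \<in> {1..N - 1} \<and> k \<noteq> l} \<subseteq> ?K"
    using cross_gens_subset[of N] by (auto simp: psi_mult psi_mvar)
  ultimately have "cross_ideal N \<subseteq> ?K"
    unfolding cross_ideal_def mpoly_ring_conv by (rule genideal_minimal)
  then show "\<forall>j\<in>{1..N - 1}. psi (e j) j p = 0" if "p \<in> cross_ideal N" using that by blast
  show "p \<in> cross_ideal N" if psi: "\<forall>j\<in>{1..N - 1}. psi (e j) j p = 0"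
  proof -
    have "Poly_Mapping.single m (Poly_Mapping.lookup p m) \<in> cross_ideal N"
      if m: "m \<in> Poly_Mapping.keys p" for m
    proof -
      have mN: "Poly_Mapping.keys m \<subseteq> {1..N - 1}" using m assms(3) by (auto simp: mpolys_def)
      have off: "\<not> Poly_Mapping.keys m \<subseteq> {j}" if "j \<in> {1..N - 1}" for j
        using psi_coeff_axis[OF assms(2)[OF that], of m j p] psi that m by (auto simp: in_keys_iff)
      have "1 \<in> {1..N - 1}" using assms(1) by auto
      then obtain k where k: "k \<in> Poly_Mapping.keys m" using off by blast
      then obtain l where "l \<in> Poly_Mapping.keys m" "k \<noteq> l" using off[of k] mN by blast
      then show ?thesis using mN k by (intro mixed_monomial_in_cross_ideal)
    qed
    then have "(\<Sum>m\<in>Poly_Mapping.keys p. Poly_Mapping.single m (Poly_Mapping.lookup p m)) \<in> cross_ideal N"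
      by (rule ideal_sum)
    then show ?thesis by (simp add: sum_of_singles)
  qed
qed

lemma psi_surj_axis:
  assumes "e \<noteq> 0" "j \<in> {1..N - 1}"
  shows "\<exists>p\<in>mpolys N. psi e j p = f"
proof (induction f)
  case 0
  interpret concrete_ring "mpolys N" by (rule concrete_ring_mpolys)
  show ?case using zero_mem by (intro bexI[of _ 0]) auto
next
  case (pCons c f)
  interpret concrete_ring "mpolys N" by (rule concrete_ring_mpolys)
  obtain p where p: "p \<in> mpolys N" "psi e j p = f" using pCons.IH by blast
  let ?q = "Poly_Mapping.single 0 c + mvar j * (Poly_Mapping.single 0 (inverse e) * p)"
  have "?q \<in> mpolys N"
    using p(1) assms(2) by (intro add_mem mult_mem mvar_mem single_mem_mpolys) auto
  moreover have "psi e j ?q = pCons c f"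
    using p(2) assms(1) by (simp add: psi_mult psi_mvar psi_const)
  ultimately show ?case by blast
qed

lemma psi_surj:
  assumes "\<And>j. j \<in> {1..N - 1} \<Longrightarrow> e j \<noteq> (0::'k::field)"
  shows "\<exists>p\<in>mpolys N. \<forall>j\<in>{1..N - 1}. psi (e j) j p = pCons c (f j)"
proof -
  interpret concrete_ring "mpolys N" by (rule concrete_ring_mpolys)
  have "\<forall>j\<in>{1..N - 1}. \<exists>p\<in>mpolys N. psi (e j) j p = smult (inverse (e j)) (f j)"
    using psi_surj_axis assms by blast
  then obtain g where g: "\<And>j. j \<in> {1..N - 1} \<Longrightarrow>
      g j \<in> mpolys N \<and> psi (e j) j (g j) = smult (inverse (e j)) (f j)"
    by metis
  let ?p = "Poly_Mapping.single 0 c + (\<Sum>j\<in>{1..N - 1}. mvar j * g j)"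
  have "?p \<in> mpolys N"
    using g by (intro add_mem sum_mem mult_mem mvar_mem single_mem_mpolys) auto
  moreover have "psi (e j) j ?p = pCons c (f j)" if j: "j \<in> {1..N - 1}" for j
  proof -
    have "(\<Sum>i\<in>{1..N - 1}. psi (e j) j (mvar i * g i))
        = (\<Sum>i\<in>{1..N - 1}. if i = j then pCons 0 (f j) else 0)"
      using g[OF j] assms[OF j] by (intro sum.cong) (auto simp: psi_mult psi_mvar)
    then show ?thesis using j by (simp add: psi_sum psi_const)
  qed
  ultimately show ?thesis by blast
qed

context affine_nTL_gaps
begin

abbreviation eps :: "nat \<Rightarrow> 'k" where "eps j \<equiv> (- 1) ^ (j - 1)"

text \<open>
  A polynomial in commuting variables with the same restrictions to the axes as \<open>a\<close> has scalars. It is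
  unique modulo the ideal.
\<close>

definition lift :: "(word \<Rightarrow>\<^sub>0 'k) set \<Rightarrow> ((nat \<Rightarrow>\<^sub>0 nat) \<Rightarrow>\<^sub>0 'k)" where
  "lift a = (SOME p. p \<in> mpolys N \<and> (\<forall>j\<in>{1..N - 1}. psi (eps j) j p = chi j a))"

lemma lift:
  assumes "a \<in> Z"
  shows "lift a \<in> mpolys N" "j \<in> {1..N - 1} \<Longrightarrow> psi (eps j) j (lift a) = chi j a"
proof -
  obtain c p where "\<forall>j\<in>{1..N - 1}. chi j a = pCons c (p j)"
    using chi_center_split[OF assms] by blast
  moreover obtain q where "q \<in> mpolys N" "\<forall>j\<in>{1..N - 1}. psi (eps j) j q = pCons c (p j)"
    using psi_surj[of N eps c p] by auto
  ultimately have "\<exists>q. q \<in> mpolys N \<and> (\<forall>j\<in>{1..N - 1}. psi (eps j) j q = chi j a)" by auto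
  from someI_ex[OF this]
  show "lift a \<in> mpolys N" "j \<in> {1..N - 1} \<Longrightarrow> psi (eps j) j (lift a) = chi j a"
    by (auto simp: lift_def)
qed

lemma cross_class_eq_iff:
  assumes "p \<in> mpolys N" "q \<in> mpolys N"
  shows "cross_class N p = cross_class N q \<longleftrightarrow> (\<forall>j\<in>{1..N - 1}. psi (eps j) j p = psi (eps j) j q)"
proof -
  interpret cross: concrete_quotient "mpolys N :: ((nat \<Rightarrow>\<^sub>0 nat) \<Rightarrow>\<^sub>0 'k) set" "cross_ideal N" by (rule concrete_quotient_cross)
  have "cross_class N p = cross_class N q \<longleftrightarrow> p - q \<in> cross_ideal N"
    unfolding cross_class_def mpoly_ring_conv by (rule cross.coset_eq_iff)
  also have "\<dots> \<longleftrightarrow> (\<forall>j\<in>{1..N - 1}. psi (eps j) j (p - q) = 0)"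
    using cross_ideal_iff[OF N2 _ cross.diff_mem[OF assms], of eps] by simp
  finally show ?thesis by simp
qed

definition center_to_cross :: "(word \<Rightarrow>\<^sub>0 'k) set \<Rightarrow> ((nat \<Rightarrow>\<^sub>0 nat) \<Rightarrow>\<^sub>0 'k) set" where
  "center_to_cross a = cross_class N (lift a)"

lemma center_to_cross_eqI:
  assumes "a \<in> Z" "p \<in> mpolys N" "\<And>j. j \<in> {1..N - 1} \<Longrightarrow> chi j a = psi (eps j) j p"
  shows "center_to_cross a = cross_class N p"
  unfolding center_to_cross_def using assms lift by (subst cross_class_eq_iff) auto

theorem center_to_cross_iso:
  "center_to_cross \<in> alg_iso (A\<lparr>carrier := Z\<rparr>) scal
     (cross_ring N) (\<lambda>c. cross_class N (Poly_Mapping.single 0 c))"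
proof -
  interpret cross: concrete_quotient "mpolys N :: ((nat \<Rightarrow>\<^sub>0 nat) \<Rightarrow>\<^sub>0 'k) set" "cross_ideal N" by (rule concrete_quotient_cross)
  have ring: "cross_ring N = (ring_on (mpolys N) Quot cross_ideal N
      :: ((nat \<Rightarrow>\<^sub>0 nat) \<Rightarrow>\<^sub>0 'k) set ring)"
    unfolding cross_ring_def mpoly_ring_conv ..
  have cls: "cross_class N = cross.coset"
    unfolding cross_class_def[abs_def] mpoly_ring_conv ..
  have le: "j \<le> N" if "j \<in> {1..N - 1}" for j using that by auto
  have cmem: "Poly_Mapping.single 0 c \<in> mpolys N" for c :: 'k by (intro single_mem_mpolys) simp
  have carrier: "carrier (cross_ring N) = cross_class N `
      (mpolys N :: ((nat \<Rightarrow>\<^sub>0 nat) \<Rightarrow>\<^sub>0 'k) set)"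
    unfolding ring cls by (rule cross.carrier_quotient)
  note ops = cross.quotient_simps[folded ring cls]
  have "inj_on center_to_cross Z"
  proof (rule inj_onI)
    fix a b assume ab: "a \<in> Z" "b \<in> Z" "center_to_cross a = center_to_cross b"
    then have "\<forall>j\<in>{1..N - 1}. psi (eps j) j (lift a) = psi (eps j) j (lift b)"
      using lift unfolding center_to_cross_def by (subst (asm) cross_class_eq_iff) auto
    then show "a = b" using ab lift(2) by (intro center_eqI) auto
  qed
  moreover have "center_to_cross ` Z = carrier (cross_ring N)"
  proof
    show "center_to_cross ` Z \<subseteq> carrier (cross_ring N)"
      unfolding carrier using lift by (auto simp: center_to_cross_def)
    show "carrier (cross_ring N) \<subseteq> center_to_cross ` Z"
    proof
      fix y :: "((nat \<Rightarrow>\<^sub>0 nat) \<Rightarrow>\<^sub>0 'k) set" assume "y \<in> carrier (cross_ring N)"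
      then obtain p where p: "p \<in> mpolys N" "y = cross_class N p" unfolding carrier by auto
      have "\<forall>j. \<exists>f. psi (eps j) j p = pCons (Poly_Mapping.lookup p 0) f"
        using psi_coeff_0 by (metis coeff_pCons_0 pCons_cases)
      then obtain f where f: "\<And>j. psi (eps j) j p = pCons (Poly_Mapping.lookup p 0) (f j)"
        by metis
      obtain a where "a \<in> Z" "\<forall>j\<in>{1..N - 1}. chi j a = pCons (Poly_Mapping.lookup p 0) (f j)"
        using center_with_chi by blast
      then have "center_to_cross a = y" unfolding p(2) using p(1) f by (intro center_to_cross_eqI) auto
      then show "y \<in> center_to_cross ` Z" using \<open>a \<in> Z\<close> by blast
    qed
  qed
  ultimately have bij: "bij_betw center_to_cross Z (carrier (cross_ring N))"
    by (simp add: bij_betw_def)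
  have "center_to_cross \<in> ring_iso (A\<lparr>carrier := Z\<rparr>) (cross_ring N)"
  proof (rule ring_iso_memI)
    fix a b assume "a \<in> carrier (A\<lparr>carrier := Z\<rparr>)" "b \<in> carrier (A\<lparr>carrier := Z\<rparr>)"
    then have ab: "a \<in> Z" "b \<in> Z" by simp_all
    have "center_to_cross (a \<otimes>\<^bsub>A\<^esub> b) = cross_class N (lift a * lift b)"
      using ab lift le Z_closed(5) Z_carrier cross.mult_mem
      by (intro center_to_cross_eqI) (auto simp: psi_mult chi_mult)
    then show "center_to_cross (a \<otimes>\<^bsub>A\<lparr>carrier := Z\<rparr>\<^esub> b)
        = center_to_cross a \<otimes>\<^bsub>cross_ring N\<^esub> center_to_cross b"
      using ops(3) lift(1) ab by (simp add: center_to_cross_def)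
    have "center_to_cross (a \<oplus>\<^bsub>A\<^esub> b) = cross_class N (lift a + lift b)"
      using ab lift le Z_closed(6) Z_carrier cross.add_mem
      by (intro center_to_cross_eqI) (auto simp: chi_add)
    then show "center_to_cross (a \<oplus>\<^bsub>A\<lparr>carrier := Z\<rparr>\<^esub> b)
        = center_to_cross a \<oplus>\<^bsub>cross_ring N\<^esub> center_to_cross b"
      using ops(4) lift(1) ab by (simp add: center_to_cross_def)
  next
    have "center_to_cross \<one>\<^bsub>A\<^esub> = cross_class N 1"
      using Z_closed(2) cross.one_mem le by (intro center_to_cross_eqI) (auto simp: chi_one psi_one)
    then show "center_to_cross \<one>\<^bsub>A\<lparr>carrier := Z\<rparr>\<^esub> = \<one>\<^bsub>cross_ring N\<^esub>" using ops(1) by simp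
  qed (use bij in \<open>auto simp: bij_betw_def\<close>)
  moreover have "center_to_cross (scal c) = cross_class N (Poly_Mapping.single 0 c)" for c
    using scalar_center cmem le by (intro center_to_cross_eqI) (auto simp: chi_scalar psi_const)
  ultimately show ?thesis by (simp add: alg_iso_def)
qed

lemma center_to_cross_t:
  assumes "k \<in> {1..N - 1}"
  shows "center_to_cross (t k) = cross_class N (mvar k)"
proof (rule center_to_cross_eqI[OF t_center[OF assms] mvar_mem[OF assms]])
  show "chi j (t k) = psi (eps j) j (mvar k)" if "j \<in> {1..N - 1}" for j
    using that chi_t[OF assms, of j] by (auto simp: psi_mvar)
qed

end

theorem theorem5p5:
  fixes N :: nat
    and gap :: "nat set \<Rightarrow> nat"
    and A :: "(word \<Rightarrow>\<^sub>0 'k::field) set ring"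
    and \<sigma> :: "'k \<Rightarrow> (word \<Rightarrow>\<^sub>0 'k) set"
    and t :: "nat \<Rightarrow> (word \<Rightarrow>\<^sub>0 'k) set"
  defines "A \<equiv> nTL N" and "\<sigma> \<equiv> nTL_scalar N" and "t \<equiv> t_elem N gap"
  assumes "N \<ge> 3"
    and "\<And>I. I \<subseteq> {1..N} \<Longrightarrow> 1 \<le> card I \<Longrightarrow> card I \<le> N - 1 \<Longrightarrow> gap I \<in> gaps N I"
  shows
    "(\<forall>k\<in>{1..N - 1}. t k \<in> ring_center A)
     \<and> ring_center A = gen_subalgebra A \<sigma> (insert \<one>\<^bsub>A\<^esub> (t ` {1..N - 1}))
     \<and> (\<forall>k\<in>{1..N - 1}. \<exists>h. h \<in> alg_iso
            (A\<lparr>carrier := gen_subalgebra A \<sigma> {t k}\<rparr>) \<sigma>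
            (ring_on (UNIV :: 'k poly set)) (\<lambda>c. [:c:]))
     \<and> (\<forall>k\<in>{1..N - 1}. \<forall>l\<in>{1..N - 1}. k \<noteq> l \<longrightarrow> t k \<otimes>\<^bsub>A\<^esub> t l = \<zero>\<^bsub>A\<^esub>)
     \<and> ring_center A = C_alg N gap
     \<and> sum_is_direct A \<sigma> {0..N - 1} (C_summand N gap)
     \<and> (\<exists>h. h \<in> alg_iso
            (A\<lparr>carrier := C_alg N gap\<rparr>) \<sigma>
            (cross_ring N) (\<lambda>c. cross_class N (Poly_Mapping.single 0 c))
          \<and> (\<forall>k\<in>{1..N - 1}. h (t k) = cross_class N (mvar k)))"
proof -
  interpret nTL: affine_nTL_gaps N "nTL_ideal N :: (word \<Rightarrow>\<^sub>0 'k) set" gap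
    by unfold_locales (use assms(4,5) in simp_all)
  note fold = A_def[symmetric] \<sigma>_def[symmetric] t_def[symmetric]
  show ?thesis
  proof (intro conjI ballI impI)
    show "t k \<in> ring_center A" if "k \<in> {1..N - 1}" for k
      using nTL.t_center[OF that] unfolding fold .
    show "ring_center A = gen_subalgebra A \<sigma> (insert \<one>\<^bsub>A\<^esub> (t ` {1..N - 1}))"
      using nTL.center_generated unfolding fold .
    show "\<exists>h. h \<in> alg_iso (A\<lparr>carrier := gen_subalgebra A \<sigma> {t k}\<rparr>) \<sigma>
        (ring_on (UNIV :: 'k poly set)) (\<lambda>c. [:c:])" if "k \<in> {1..N - 1}" for k
      using nTL.t_polynomial_ring[OF that] unfolding fold by blast
    show "t k \<otimes>\<^bsub>A\<^esub> t l = \<zero>\<^bsub>A\<^esub>" if "k \<in> {1..N - 1}" "l \<in> {1..N - 1}" "k \<noteq> l" for k l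
      using nTL.t_orthogonal[OF that] unfolding fold .
    show "ring_center A = C_alg N gap"
      using nTL.center_eq_C_alg unfolding fold .
    show "sum_is_direct A \<sigma> {0..N - 1} (C_summand N gap)"
      using nTL.sum_V_direct unfolding fold .
    show "\<exists>h. h \<in> alg_iso (A\<lparr>carrier := C_alg N gap\<rparr>) \<sigma>
          (cross_ring N) (\<lambda>c. cross_class N (Poly_Mapping.single 0 c))
        \<and> (\<forall>k\<in>{1..N - 1}. h (t k) = cross_class N (mvar k))"
      using nTL.center_to_cross_iso nTL.center_to_cross_t
      unfolding nTL.center_eq_C_alg unfolding fold by blast
  qed
qed

end
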